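(* Let $n>d\ge1$ be integers, $\omega>0$, and $\widetilde{\bm{A}}\in\mathbb{R}^{(d+1)\times(n-d)}$ with $\inf_{\bm{j}\in\mathbb{Z}^{n-d}\setminus\{\bm{0}\}}|\bm{j}|^\omega\prod_{u=1}^{d+1}\|\bm{j}\cdot\mathrm{row}_u(\widetilde{\bm{A}})\|>0$. For $Q\in\mathbb{N}$ and $\delta>0$ let $$\mathcal{N}(Q,\delta)=\#\{\widetilde{\bm{a}}\in\mathbb{N}^{d+1}:\|\widetilde{\bm{a}}\cdot\widetilde{\bm{A}}\|<\delta,\ |\widetilde{\bm{a}}|\le Q\}.$$ Then for every $\varepsilon>0$ there is a constant $C_\varepsilon$ depending only on $\varepsilon$ and $\widetilde{\bm{A}}$ such that for all $Q\in\mathbb{N}$ and $\delta\in(0,1/2]$, $$\big|\mathcal{N}(Q,\delta)-(2\delta)^{n-d}Q^{d+1}\big|\le\varepsilon\delta^{n-d}Q^{d+1}+C_\varepsilon\delta^{n-d-\omega}\Big(\log\frac1\delta\Big)^{d+1}.$$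
   Context: Vectors are row vectors; $\mathrm{row}_u(\widetilde{\bm{A}})$ is the $u$-th row of $\widetilde{\bm{A}}$; $\|y\|$ is the distance from $y\in\mathbb{R}$ to the nearest integer and for vectors $\|\bm{y}\|=\max_k\|y_k\|$; $|\cdot|$ is the supremum norm. *)

theory Defs
  imports "HOL-Analysis.Analysis"
begin

definition int_dist :: "real \<Rightarrow> real" where
  "int_dist y = infdist y \<int>"

definition int_dist_vec :: "real ^ 'c \<Rightarrow> real" where
  "int_dist_vec y = Max (range (\<lambda>k. int_dist (y $ k)))"

definition vec_of_int :: "int ^ 'c \<Rightarrow> real ^ 'c" where
  "vec_of_int j = (\<chi> k. of_int (j $ k))"

definition vec_of_nat :: "nat ^ 'r \<Rightarrow> real ^ 'r" where
  "vec_of_nat a = (\<chi> u. of_nat (a $ u))"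

text \<open>
  The natural numbers are the positive integers here, hence the condition \<open>1 \<le> a $ u\<close>.
\<close>
definition near_int_points :: "real ^ 'c ^ 'r \<Rightarrow> nat \<Rightarrow> real \<Rightarrow> (nat ^ 'r) set" where
  "near_int_points A Q \<delta> =
     {a. (\<forall>u. 1 \<le> a $ u) \<and> int_dist_vec (vec_of_nat a v* A) < \<delta> \<and>
         infnorm (vec_of_nat a) \<le> real Q}"

lemma finite_near_int_points: "finite (near_int_points A Q \<delta>)"
proof (rule finite_subset)
  show "near_int_points A Q \<delta> \<subseteq> vec_lambda ` (UNIV \<rightarrow>\<^sub>E {..Q})"
  proof
    fix a assume "a \<in> near_int_points A Q \<delta>"
    then have le: "infnorm (vec_of_nat a) \<le> real Q"
      by (simp add: near_int_points_def)
    have "a $ u \<le> Q" for u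
    proof -
      have "\<bar>vec_of_nat a $ u\<bar> \<le> real Q"
        using component_le_infnorm_cart[of "vec_of_nat a" u] le by linarith
      then show ?thesis by (simp add: vec_of_nat_def)
    qed
    then show "a \<in> vec_lambda ` (UNIV \<rightarrow>\<^sub>E {..Q})"
      by (intro image_eqI[of _ _ "vec_nth a"]) auto
  qed
  show "finite (vec_lambda ` (UNIV \<rightarrow>\<^sub>E {..Q}))"
    by (intro finite_imageI finite_PiE) auto
qed

definition near_int_count :: "real ^ 'c ^ 'r \<Rightarrow> nat \<Rightarrow> real \<Rightarrow> nat" where
  "near_int_count A Q \<delta> = card (near_int_points A Q \<delta>)"

end

theory Submission imports Defs begin

text \<open>
  The indicator of the box \<open>\<parallel>y\<^sub>k\<parallel> < \<delta>\<close> is compared with trigonometric polynomials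
  of degree \<open>O\<^sub>\<epsilon>(1/\<delta>)\<close>. Summing such a polynomial over the points \<open>a A\<close>, its mean gives
  the main term, and geometric sums bound the remainder by \<open>\<delta> ^ (n - d)\<close> times the sum over
  \<open>0 < |j| \<le> D\<close> of the products over \<open>u\<close> of \<open>1 / \<parallel>j \<cdot> row u A\<parallel>\<close>. The Diophantine condition applied
  to differences \<open>j - j'\<close> separates the points \<open>(j \<cdot> row u A)\<^sub>u\<close> on the torus, so each dyadic box
  contributes \<open>O(D powr \<omega>)\<close> to that sum, and there are \<open>O((log D) ^ (d + 1))\<close> boxes.

  The polynomials are products \<open>f\<close> of one-variable convolutions \<open>T\<close> of an interval with the Jackson
  kernel, taken on a finite grid so that all means are finite sums. For the majorant one
  divides by the minimum of \<open>f\<close> on the box. The minorant is \<open>f\<^sup>2 - \<eta> f\<close>: it is at most 1 since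
  \<open>0 \<le> f \<le> 1\<close>, and nonpositive outside the box since \<open>f \<le> \<eta>\<close> there.
\<close>

subsection \<open>Distance to the nearest integer and exponential sums\<close>

text \<open>The infimum over the integers is attained at the rounding, which turns later claims
  about \<open>int_dist\<close> into linear arithmetic.\<close>

lemma int_dist_eq_abs_round: "int_dist y = \<bar>y - of_int (round y)\<bar>"
proof -
  have "infdist y \<int> = (INF a\<in>\<int>. dist y a)"
    by (rule infdist_notempty) auto
  also have "\<dots> = \<bar>y - of_int (round y)\<bar>"
    by (rule cInf_eq_minimum) (auto simp: dist_real_def Ints_def round_diff_minimal)
  finally show ?thesis by (simp add: int_dist_def)
qed

lemma int_dist_le: "int_dist y \<le> \<bar>y - of_int m\<bar>"
  using round_diff_minimal[of y m] by (simp add: int_dist_eq_abs_round)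

lemma int_dist_nonneg: "0 \<le> int_dist y"
  by (simp add: int_dist_def infdist_nonneg)

lemma int_dist_le_half: "int_dist y \<le> 1/2"
  using of_int_round_abs_le[of y] by (simp add: int_dist_eq_abs_round abs_minus_commute)

lemma int_dist_minus [simp]: "int_dist (- y) = int_dist y"
proof -
  have "int_dist (- x) \<le> int_dist x" for x
    using int_dist_le[of "-x" "- round x"] by (simp add: int_dist_eq_abs_round[of x])
  from this[of y] this[of "-y"] show ?thesis by simp
qed

lemma int_dist_triangle: "int_dist (x + y) \<le> int_dist x + int_dist y"
  using int_dist_le[of "x + y" "round x + round y"]
    by (simp add: int_dist_eq_abs_round[of x] int_dist_eq_abs_round[of y])

lemma int_dist_eq_self:
  assumes "0 \<le> y" "y \<le> 1/2" shows "int_dist y = y"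
proof (rule antisym)
  show "int_dist y \<le> y" using int_dist_le[of y 0] assms by simp
  show "y \<le> int_dist y"
  proof (cases "round y \<le> 0")
    case True
    then have "real_of_int (round y) \<le> 0" by simp
    then show ?thesis unfolding int_dist_eq_abs_round by linarith
  next
    case False
    then have "real_of_int (round y) \<ge> 1" by simp
    then show ?thesis unfolding int_dist_eq_abs_round using assms by linarith
  qed
qed

lemma int_dist_of_int_diff [simp]: "int_dist (of_int m - y) = int_dist y"
proof (rule antisym)
  have [simp]: "int_dist (of_int m) = 0" for m
    using int_dist_le[of "of_int m" m] int_dist_nonneg[of "of_int m"] by simp
  show "int_dist (of_int m - y) \<le> int_dist y"
    using int_dist_triangle[of "of_int m" "-y"] by simp
  show "int_dist y \<le> int_dist (of_int m - y)"
    using int_dist_triangle[of "of_int m" "y - of_int m"] int_dist_minus[of "y - of_int m"] by simp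
qed

text \<open>Put y = x/2. The function sin y - y cos y has derivative y sin y >= 0, so y cos y <= sin
  y. Doubling the angle gives x cos(y)^2 <= sin x, and cos x >= 0 forces cos(y)^2 >= 1/2.\<close>

lemma sin_ge_half:
  fixes x :: real
  assumes "0 \<le> x" "x \<le> pi / 2"
  shows "x / 2 \<le> sin x"
proof -
  define y where "y = x / 2"
  have y: "0 \<le> y" "y \<le> pi / 2" using assms by (auto simp: y_def)
  have "sin 0 - 0 * cos 0 \<le> sin y - y * cos y"
  proof (rule DERIV_nonneg_imp_nondecreasing[OF y(1), of "\<lambda>y. sin y - y * cos y"])
    fix z assume z: "0 \<le> z" "z \<le> y"
    have "((\<lambda>y. sin y - y * cos y) has_real_derivative z * sin z) (at z)"
      by (auto intro!: derivative_eq_intros)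
    moreover have "0 \<le> z * sin z" using z y by (auto intro!: mult_nonneg_nonneg sin_ge_zero)
    ultimately show "\<exists>d. ((\<lambda>y. sin y - y * cos y) has_real_derivative d) (at z) \<and> 0 \<le> d" by blast
  qed
  then have "y * cos y \<le> sin y" by simp
  moreover have "0 \<le> cos y" using y by (auto intro!: cos_ge_zero)
  ultimately have "2 * (y * cos y) * cos y \<le> 2 * sin y * cos y"
    by (intro mult_right_mono) auto
  then have 1: "x * (cos y)\<^sup>2 \<le> sin x"
    using sin_double[of y] by (simp add: y_def power2_eq_square mult_ac)
  have "cos x = 2 * (cos y)\<^sup>2 - 1" using cos_double_cos[of y] by (simp add: y_def)
  moreover have "0 \<le> cos x" using assms by (auto intro!: cos_ge_zero)
  ultimately have "1/2 \<le> (cos y)\<^sup>2" by simp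
  then have "x * (1/2) \<le> x * (cos y)\<^sup>2" using assms by (intro mult_left_mono) auto
  with 1 show ?thesis by simp
qed

section \<open>Additive characters and geometric sums\<close>

definition ef :: "real \<Rightarrow> complex" where
  "ef x = cis (2 * pi * x)"

lemma ef_0 [simp]: "ef 0 = 1" by (simp add: ef_def)

lemma norm_ef [simp]: "norm (ef x) = 1" by (simp add: ef_def)

lemma ef_add: "ef (x + y) = ef x * ef y"
  by (simp add: ef_def cis_mult algebra_simps)

lemma ef_of_int [simp]: "ef (of_int m) = 1"
  by (simp add: ef_def cis_multiple_2pi)

lemma ef_minus: "ef (- x) = cnj (ef x)"
  by (simp add: ef_def cis_cnj)

lemma ef_power: "ef x ^ n = ef (real n * x)"
  unfolding ef_def Complex.DeMoivre by (simp add: mult_ac)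

lemma ef_sum: "ef (sum f S) = (\<Prod>x\<in>S. ef (f x))"
  by (induction S rule: infinite_finite_induct) (auto simp: ef_add)

text \<open>The chord has length exactly 2 sin(pi z) with z = \<open>int_dist y\<close>. Since pi z
  lies in [0, pi/2], the preceding sine bound applies.\<close>

lemma norm_one_minus_ef: "norm (1 - ef y) \<ge> 2 * int_dist y"
proof -
  define z where "z = int_dist y"
  have z: "0 \<le> z" "z \<le> 1/2" unfolding z_def by (rule int_dist_nonneg, rule int_dist_le_half)
  have "ef y = ef (y - of_int (round y))"
    using ef_add[of "y - of_int (round y)" "of_int (round y)"] by simp
  \<comment> \<open>Modulo 1, y is z or -z; the second case is the complex conjugate of the
    first.\<close>
  then have "norm (1 - ef y) = norm (1 - ef z)"
  proof (cases "y - of_int (round y) \<ge> 0")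
    case True
    then have "z = y - of_int (round y)" by (simp add: z_def int_dist_eq_abs_round)
    then show ?thesis using \<open>ef y = _\<close> by simp
  next
    case False
    then have "y - of_int (round y) = - z" by (simp add: z_def int_dist_eq_abs_round)
    then have "ef y = cnj (ef z)" using \<open>ef y = _\<close> by (simp add: ef_minus)
    then have "1 - ef y = cnj (1 - ef z)" by simp
    then show ?thesis by (metis complex_mod_cnj)
  qed
  also have "\<dots> = 2 * sin (pi * z)"
  proof -
    have "(norm (1 - ef z))\<^sup>2 = (1 - cos (2 * (pi * z)))\<^sup>2 + (sin (2 * (pi * z)))\<^sup>2"
      by (simp add: cmod_power2 ef_def mult_ac)
    also have "\<dots> = 2 - 2 * cos (2 * (pi * z))"
      using sin_cos_squared_add[of "2 * (pi * z)"] by (simp add: power2_diff)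
    also have "\<dots> = (2 * sin (pi * z))\<^sup>2"
      by (simp add: cos_double_sin power_mult_distrib)
    finally have "norm (1 - ef z) = \<bar>2 * sin (pi * z)\<bar>"
      by (metis abs_norm_cancel power2_eq_iff_nonneg power2_abs abs_ge_zero)
    moreover have "0 \<le> sin (pi * z)" using z
      by (intro sin_ge_zero) (auto simp: mult_le_cancel_left1)
    ultimately show ?thesis by simp
  qed
  also have "\<dots> \<ge> 2 * (pi * z / 2)"
    using sin_ge_half[of "pi * z"] z mult_left_mono[of z "1/2" pi] by simp
  also have "2 * (pi * z / 2) \<ge> 2 * z" using z pi_gt3 by (auto intro!: mult_right_mono)
  finally show ?thesis by (simp add: z_def)
qed

text \<open>A geometric sum: the numerator has modulus at most 2 and the denominator at least 2
  \<open>int_dist \<theta>\<close>, so the bound is uniform in \<open>Q\<close>.\<close>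

lemma norm_sum_ef_le:
  assumes "int_dist \<theta> > 0"
  shows "norm (\<Sum>a=1..Q. ef (real a * \<theta>)) \<le> 1 / int_dist \<theta>"
proof -
  have n0: "norm (1 - ef \<theta>) > 0" using norm_one_minus_ef[of \<theta>] assms by linarith
  then have ne: "ef \<theta> \<noteq> 1" by auto
  have "(\<Sum>a=1..Q. ef (real a * \<theta>)) = ef \<theta> * (\<Sum>a<Q. ef \<theta> ^ a)"
    unfolding sum_distrib_left
    by (rule sum.reindex_bij_witness[of _ Suc "\<lambda>a. a
      - 1"]) (auto simp: ef_power[symmetric] power_eq_if)
  then have "norm (\<Sum>a=1..Q. ef (real a * \<theta>)) = norm (\<Sum>a<Q. ef \<theta> ^ a)"
    by (simp add: norm_mult)
  also have "\<dots> = norm (1 - ef \<theta> ^ Q) / norm (1 - ef \<theta>)"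
    using ne by (simp add: sum_gp_strict norm_divide)
  also have "\<dots> \<le> 2 / norm (1 - ef \<theta>)"
    using norm_triangle_ineq4[of 1 "ef \<theta> ^ Q"] by (intro divide_right_mono) (auto simp: norm_power)
  also have "\<dots> \<le> 2 / (2 * int_dist \<theta>)"
    using norm_one_minus_ef[of \<theta>] assms by (intro divide_left_mono mult_pos_pos n0) auto
  finally show ?thesis by simp
qed

lemma int_dist_frac_pos:
  fixes M :: nat and m :: int
  assumes "m \<noteq> 0" "\<bar>m\<bar> < int M"
  shows "int_dist (of_int m / real M) > 0"
proof -
  have M: "M > 0" using assms by linarith
  have "of_int m / real M \<noteq> of_int k" for k
  proof
    assume "of_int m / real M = of_int k"
    then have "real_of_int m = of_int (k * int M)" using M by (simp add: field_simps)
    then have "m = k * int M" by linarith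
    then show False using assms
      by (metis abs_mult abs_of_nat dvd_triv_right zdvd_imp_le zero_less_abs_iff dvd_abs_iff not_less)
  qed
  then show ?thesis unfolding int_dist_eq_abs_round by simp
qed

text \<open>A geometric sum over powers of an \<open>M\<close>-th root of unity. The condition |m| <
  M makes that root different from 1 unless m = 0.\<close>

lemma sum_ef_orthogonal:
  fixes M :: nat and m :: int
  assumes "\<bar>m\<bar> < int M"
  shows "(\<Sum>i<M. ef (of_int m * (real i / real M))) = (if m = 0 then of_nat M else 0)"
proof (cases "m = 0")
  case False
  have M: "M > 0" using assms by linarith
  let ?z = "ef (of_int m / real M)"
  have "norm (1 - ?z) > 0"
    using norm_one_minus_ef[of "of_int m / real M"] int_dist_frac_pos[OF False assms] by linarith
  then have "?z \<noteq> 1" by auto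
  have "(\<Sum>i<M. ef (of_int m * (real i / real M))) = (\<Sum>i<M. ?z ^ i)"
    by (intro sum.cong) (auto simp: ef_power mult_ac)
  also have "\<dots> = (1 - ?z ^ M) / (1 - ?z)" using \<open>?z \<noteq> 1\<close> by (simp add: sum_gp_strict)
  also have "?z ^ M = 1" using M by (simp add: ef_power)
  finally show ?thesis using False by simp
qed simp

subsection \<open>Trigonometric polynomials and the Jackson kernel\<close>

text \<open>The degree bound \<open>D\<close> belongs to the predicate because it decides how fine a
  grid recovers the coefficients.\<close>

definition trig_poly :: "nat \<Rightarrow> (int \<Rightarrow> complex) \<Rightarrow> (real \<Rightarrow> real) \<Rightarrow> bool" where
  "trig_poly D c g \<longleftrightarrow> (\<forall>x. of_real (g x) = (\<Sum>j=-int D..int D. c j * ef (of_int j * x)))"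

text \<open>A representation may repeat frequencies; coefficients are obtained by collecting the
  indices with the same \<open>\<phi> i\<close>.\<close>

lemma trig_polyI:
  assumes "finite S" and "\<And>i. i \<in> S \<Longrightarrow> \<bar>\<phi> i\<bar> \<le> int D"
    and "\<And>x. of_real (g x) = (\<Sum>i\<in>S. b i * ef (of_int (\<phi> i) * x))"
  shows "\<exists>c. trig_poly D c g"
proof
  show "trig_poly D (\<lambda>j. \<Sum>i\<in>{i\<in>S. \<phi> i = j}. b i) g"
    unfolding trig_poly_def
  proof
    fix x
    have "(\<Sum>j=-int D..int D. (\<Sum>i\<in>{i\<in>S. \<phi> i = j}. b i) * ef (of_int j * x))
        = (\<Sum>j=-int D..int D. (\<Sum>i\<in>{i\<in>S. \<phi> i = j}. b i * ef (of_int (\<phi> i) * x)))"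
      by (intro sum.cong refl) (auto simp: sum_distrib_right)
    also have "\<dots> = (\<Sum>i\<in>S. b i * ef (of_int (\<phi> i) * x))"
      using assms(2) by (intro sum.group assms(1)) (auto simp: abs_le_iff, force+)
    finally show "of_real (g x) = (\<Sum>j=-int D..int D. (\<Sum>i\<in>{i\<in>S. \<phi> i = j}. b i) * ef (of_int j * x))"
      by (simp add: assms(3))
  qed
qed

lemma trig_poly_mult:
  assumes "trig_poly D c f" "trig_poly E b g"
  shows "\<exists>a. trig_poly (D + E) a (\<lambda>x. f x * g x)"
proof (rule trig_polyI[where S = "{-int D..int D} \<times> {-int E..int E}"
      and \<phi> = "\<lambda>(j,k). j + k" and b = "\<lambda>(j,k). c j * b k"])
  fix x
  have "complex_of_real (f x * g x)
    = (\<Sum>j=-int D..int D. c j * ef (of_int j * x)) * (\<Sum>k=-int E..int E. b k * ef (of_int k * x))"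
    using assms by (simp add: trig_poly_def)
  also have "\<dots> = (\<Sum>(j,k)\<in>{-int D..int D} \<times> {-int E..int E}. (c j * ef (of_int j * x)) * (b k
    * ef (of_int k * x)))"
    by (simp add: sum_product sum.cartesian_product)
  finally show "of_real (f x * g x)
    = (\<Sum>i\<in>{-int D..int D} \<times> {-int E..int E}. (case i of (j, k) \<Rightarrow> c j * b k)
    * ef (of_int (case i of (j, k) \<Rightarrow> j + k) * x))"
    by (simp add: case_prod_beta ring_distribs ef_add mult_ac)
qed auto

text \<open>The grid substitute for the integral over the circle; on trigonometric polynomials of
  degree below \<open>M\<close> the two agree.\<close>

definition dmean :: "nat \<Rightarrow> (real \<Rightarrow> real) \<Rightarrow> real" where
  "dmean M g = (\<Sum>i<M. g (real i / real M)) / real M"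

text \<open>Discrete Fourier inversion. As both frequencies are at most \<open>D\<close> in modulus
  and 2D < M, their difference stays below \<open>M\<close>, so orthogonality isolates the term k =
  j.\<close>

lemma trig_poly_coeff:
  assumes "trig_poly D c g" "2 * D < M" "\<bar>j\<bar> \<le> int D"
  shows "c j = (\<Sum>i<M. of_real (g (real i / real M)) * ef (- (of_int j
    * (real i / real M)))) / of_nat M"
proof -
  have "(\<Sum>i<M. of_real (g (real i / real M)) * ef (- (of_int j * (real i / real M))))
      = (\<Sum>i<M. \<Sum>k=-int D..int D. c k * ef (of_int (k - j) * (real i / real M)))"
  proof (intro sum.cong refl)
    fix i
    have "of_real (g (real i / real M)) * ef (- (of_int j * (real i / real M)))
        = (\<Sum>k=-int D..int D. c k * (ef (of_int k * (real i / real M)) * ef (- (of_int j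
        * (real i / real M)))))"
      unfolding assms(1)[unfolded trig_poly_def, rule_format] sum_distrib_right
        by (simp only: mult.assoc)
    then show "of_real (g (real i / real M)) * ef (- (of_int j * (real i / real M)))
       = (\<Sum>k=-int D..int D. c k * ef (of_int (k - j) * (real i / real M)))"
      by (simp add: ef_add[symmetric] left_diff_distrib diff_divide_distrib)
  qed
  also have "\<dots> = (\<Sum>k=-int D..int D. c k * (\<Sum>i<M. ef (of_int (k - j) * (real i / real M))))"
    by (subst sum.swap) (simp only: sum_distrib_left)
  also have "\<dots> = (\<Sum>k=-int D..int D. if k = j then c k * of_nat M else 0)"
  proof (intro sum.cong refl)
    fix k assume "k \<in> {-int D..int D}"
    then have "\<bar>k - j\<bar> < int M" using assms(2,3) by auto
    then show "c k * (\<Sum>i<M. ef (of_int (k - j) * (real i / real M))) = (if k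
      = j then c k * of_nat M else 0)"
      by (subst sum_ef_orthogonal) auto
  qed
  also have "\<dots> = c j * of_nat M" using assms(3) by (simp add: abs_le_iff)
  finally show ?thesis using assms(2) by simp
qed

lemma trig_poly_coeff_0:
  assumes "trig_poly D c g" "2 * D < M"
  shows "c 0 = of_real (dmean M g)"
  using trig_poly_coeff[OF assms, of 0] by (simp add: dmean_def)

text \<open>The triangle inequality in the inversion formula, where nonnegativity removes the
  absolute values. Every coefficient is thus as small as the mean, which is the source of the factor
  \<delta> ^ (n - d) in the error term.\<close>

lemma trig_poly_coeff_norm_le:
  assumes "trig_poly D c g" "2 * D < M" "\<bar>j\<bar> \<le> int D" "\<And>x. 0 \<le> g x"
  shows "norm (c j) \<le> dmean M g"
proof -
  have "norm (c j)
    \<le> (\<Sum>i<M. norm (of_real (g (real i / real M)) * ef (- (of_int j * (real i / real M))))) / real M"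
    unfolding trig_poly_coeff[OF assms(1-3)] norm_divide norm_of_nat
      by (intro divide_right_mono sum_norm_le) auto
  also have "\<dots> = dmean M g"
    using assms(4) by (simp add: dmean_def norm_mult)
  finally show ?thesis .
qed

lemma discrete_parseval:
  fixes b :: "nat \<Rightarrow> real"
  assumes "L < M"
  shows "(\<Sum>i<M. (norm (\<Sum>n\<le>L. of_real (b n) * ef (real n * (x - real i / real M))))\<^sup>2)
    = real M * (\<Sum>n\<le>L. (b n)\<^sup>2)"
proof -
  let ?y = "\<lambda>i. x - real i / real M"
  have "complex_of_real (\<Sum>i<M. (norm (\<Sum>n\<le>L. of_real (b n) * ef (real n * ?y i)))\<^sup>2)
     = (\<Sum>i<M. \<Sum>n\<le>L. \<Sum>m\<le>L. of_real (b n) * of_real (b m) * ef (of_int (int n - int m) * x)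
     * ef (of_int (int m - int n) * (real i / real M)))"
    unfolding of_real_sum
  proof (intro sum.cong refl)
    fix i
    \<comment> \<open>This separates the shift \<open>x\<close> from the grid point, so that the sum
      over \<open>i\<close> sees the pure integer frequency m - n.\<close>
    have *: "ef (real n * ?y i) * ef (- (real m * ?y i))
      = ef (of_int (int n - int m) * x) * ef (of_int (int m - int n) * (real i / real M))" for n m
      unfolding ef_add[symmetric]
        by (rule arg_cong[where f = ef]) (simp add: algebra_simps diff_divide_distrib)
    have "complex_of_real ((norm (\<Sum>n\<le>L. of_real (b n) * ef (real n * ?y i)))\<^sup>2)
       = (\<Sum>n\<le>L. of_real (b n) * ef (real n * ?y i)) * (\<Sum>m\<le>L. of_real (b m) * ef (- (real m
       * ?y i)))"
      by (simp only: complex_norm_square cnj_sum complex_cnj_mult complex_cnj_complex_of_real ef_minus)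
    also have "\<dots> = (\<Sum>n\<le>L. \<Sum>m\<le>L. of_real (b n) * of_real (b m) * (ef (real n * ?y i) * ef (- (real m
      * ?y i))))"
      unfolding sum_product by (intro sum.cong refl) (simp add: mult_ac)
    also have "\<dots> = (\<Sum>n\<le>L. \<Sum>m\<le>L. of_real (b n) * of_real (b m) * ef (of_int (int n - int m) * x)
      * ef (of_int (int m - int n) * (real i / real M)))"
      unfolding * by (simp only: mult.assoc)
    finally show "complex_of_real ((norm (\<Sum>n\<le>L. of_real (b n) * ef (real n * ?y i)))\<^sup>2) = \<dots>" .
  qed
  also have "\<dots> = (\<Sum>n\<le>L. \<Sum>m\<le>L. \<Sum>i<M. of_real (b n) * of_real (b m) * ef (of_int (int n - int m) * x)
    * ef (of_int (int m - int n) * (real i / real M)))"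
    by (rule trans[OF sum.swap], rule sum.cong[OF refl], rule sum.swap)
  also have "\<dots> = (\<Sum>n\<le>L. \<Sum>m\<le>L. of_real (b n) * of_real (b m) * ef (of_int (int n - int m) * x)
    * (\<Sum>i<M. ef (of_int (int m - int n) * (real i / real M))))"
    by (simp only: sum_distrib_left)
  also have "\<dots> = (\<Sum>n\<le>L. \<Sum>m\<le>L. if m = n then of_real (b n) * of_real (b n) * of_nat M else 0)"
  proof (intro sum.cong refl)
    fix n m assume "n \<in> {..L}" "m \<in> {..L}"
    then have "\<bar>int m - int n\<bar> < int M" using assms by auto
    then show "of_real (b n) * of_real (b m) * ef (of_int (int n - int m) * x)
      * (\<Sum>i<M. ef (of_int (int m - int n) * (real i / real M)))
       = (if m = n then of_real (b n) * of_real (b n) * of_nat M else 0)"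
      by (subst sum_ef_orthogonal) auto
  qed
  also have "\<dots> = complex_of_real (real M * (\<Sum>n\<le>L. (b n)\<^sup>2))"
    by (simp add: sum_distrib_left power2_eq_square mult_ac)
  finally show ?thesis by (simp only: of_real_eq_iff)
qed

section \<open>The Jackson kernel: normalisation and tail\<close>

definition tent :: "nat \<Rightarrow> nat \<Rightarrow> real" where
  "tent N n = real (min n (2 * N - n))"

text \<open>With z = \<open>ef y\<close> this is z (1 + z + ... + z^(N-1))^2. Its squared modulus is
  therefore the fourth power of |sin(pi N y) / sin(pi y)|, the unnormalised Jackson kernel.\<close>

definition tent_poly :: "nat \<Rightarrow> real \<Rightarrow> complex" where
  "tent_poly N y = (\<Sum>n\<le>2*N. of_real (tent N n) * ef (real n * y))"

definition tent_norm2 :: "nat \<Rightarrow> real" where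
  "tent_norm2 N = (\<Sum>n\<le>2*N. (tent N n)\<^sup>2)"

definition jackson :: "nat \<Rightarrow> real \<Rightarrow> real" where
  "jackson N y = (norm (tent_poly N y))\<^sup>2 / tent_norm2 N"

text \<open>Only the rising half n <= N is kept, where the coefficients are n.\<close>

lemma tent_norm2_ge: "real N ^ 3 / 3 \<le> tent_norm2 N"
proof -
  have "real N ^ 3 \<le> 3 * (\<Sum>n\<le>N. (real n)\<^sup>2)"
  proof (induction N)
    case (Suc N)
    then show ?case by (simp add: power3_eq_cube power2_eq_square algebra_simps)
  qed simp
  moreover have "(\<Sum>n\<le>N. (real n)\<^sup>2) = (\<Sum>n\<le>N. (tent N n)\<^sup>2)"
    by (intro sum.cong refl) (auto simp: tent_def min_def)
  moreover have "\<dots> \<le> tent_norm2 N"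
    unfolding tent_norm2_def by (intro sum_mono2) auto
  ultimately show ?thesis by simp
qed

lemma jackson_nonneg: "0 \<le> jackson N y"
  by (auto simp: jackson_def tent_norm2_def intro!: divide_nonneg_nonneg sum_nonneg)

text \<open>Discrete Parseval: dividing by \<open>tent_norm2 N\<close> normalises the kernel to grid
  mean exactly 1, whatever the shift \<open>x\<close>.\<close>

lemma sum_jackson:
  assumes "2 * N < M" "N \<ge> 1"
  shows "(\<Sum>i<M. jackson N (x - real i / real M)) = real M"
proof -
  have "tent_norm2 N > 0" using tent_norm2_ge[of N] assms
    by (smt (verit) divide_pos_pos of_nat_0_less_iff zero_less_power less_le_trans less_numeral_extra(1))
  then show ?thesis
    using discrete_parseval[OF assms(1), of "tent N" x]
    by (simp add: jackson_def tent_poly_def tent_norm2_def flip: sum_divide_distrib)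
qed

text \<open>Summation by parts. The tent vanishes at both ends, so no boundary terms
  survive.\<close>

lemma one_minus_ef_tent_poly:
  "(1 - ef y) * tent_poly N y = (\<Sum>n\<le>2*N. of_real (tent N n - tent N (n - 1)) * ef (real n * y))"
proof -
  have "ef y * tent_poly N y = (\<Sum>n\<le>2*N. of_real (tent N n) * ef (real (Suc n) * y))"
    unfolding tent_poly_def sum_distrib_left
      by (intro sum.cong refl) (simp add: ring_distribs ef_add mult_ac)
  also have "\<dots> = (\<Sum>n\<in>{1..Suc (2*N)}. of_real (tent N (n - 1)) * ef (real n * y))"
    by (rule sum.reindex_bij_witness[of _ "\<lambda>n. n - 1" Suc]) auto
  \<comment> \<open>The dropped index 2N + 1 carries \<open>tent N (2*N)\<close> = 0; the index 0
    added next carries 0 because natural subtraction makes 0 - 1 = 0.\<close>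
  also have "\<dots> = (\<Sum>n\<in>{1..2*N}. of_real (tent N (n - 1)) * ef (real n * y))"
    by (simp add: tent_def)
  also have "\<dots> = (\<Sum>n\<le>2*N. of_real (tent N (n - 1)) * ef (real n * y))"
    by (intro sum.mono_neutral_left) (auto simp: tent_def not_le)
  finally have "ef y * tent_poly N y = (\<Sum>n\<le>2*N. of_real (tent N (n - 1)) * ef (real n * y))" .
  then show ?thesis
    by (simp add: left_diff_distrib sum_subtractf) (simp add: tent_poly_def)
qed

text \<open>A Chebyshev argument. On \<open>J\<close> the factor |1 - ef y|^2 is at least 4 t^2;
  after inserting it the sum is extended to the whole grid and evaluated by Parseval. The squared
  differences of the tent sum to at most 2N, against a normalisation of at least N^3 / 3.\<close>

lemma sum_jackson_tail:
  assumes "2 * N < M" "N \<ge> 1" "t > 0" "J \<subseteq> {..<M}" "\<And>i. i \<in> J \<Longrightarrow> t \<le> int_dist (x - real i / real M)"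
  shows "(\<Sum>i\<in>J. jackson N (x - real i / real M)) \<le> real M * (2 / (real N * t)\<^sup>2)"
proof -
  let ?y = "\<lambda>i. x - real i / real M"
  have W: "real N ^ 3 / 3 \<le> tent_norm2 N" by (rule tent_norm2_ge)
  have N3: "real N ^ 3 > 0" using assms(2) by simp
  then have W0: "tent_norm2 N > 0" using W by linarith
  have "(\<Sum>i\<in>J. jackson N (?y i))
    \<le> (\<Sum>i\<in>J. (norm ((1 - ef (?y i)) * tent_poly N (?y i)))\<^sup>2 / (4 * t\<^sup>2 * tent_norm2 N))"
  proof (intro sum_mono)
    fix i assume "i \<in> J"
    then have "2 * t \<le> norm (1 - ef (?y i))"
      using assms(5) norm_one_minus_ef[of "?y i"]
        by (meson mult_left_mono order_trans zero_le_numeral)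
    then have "(2 * t)\<^sup>2 \<le> (norm (1 - ef (?y i)))\<^sup>2" using assms(3) by (intro power_mono) auto
    then have "(2 * t)\<^sup>2 * (norm (tent_poly N (?y i)))\<^sup>2
      \<le> (norm (1 - ef (?y i)))\<^sup>2 * (norm (tent_poly N (?y i)))\<^sup>2"
      by (intro mult_right_mono) auto
    then show "jackson N (?y i)
      \<le> (norm ((1 - ef (?y i)) * tent_poly N (?y i)))\<^sup>2 / (4 * t\<^sup>2 * tent_norm2 N)"
      unfolding jackson_def norm_mult power_mult_distrib using W0 assms(3)
      by (simp only: divide_simps) (simp add: mult_ac)
  qed
  also have "\<dots> \<le> (\<Sum>i<M. (norm ((1 - ef (?y i)) * tent_poly N (?y i)))\<^sup>2 / (4 * t\<^sup>2 * tent_norm2 N))"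
    using W0 assms(4) by (intro sum_mono2) auto
  also have "\<dots> = (real M * (\<Sum>n\<le>2*N. (tent N n - tent N (n - 1))\<^sup>2)) / (4 * t\<^sup>2 * tent_norm2 N)"
    unfolding one_minus_ef_tent_poly
      by (simp only: sum_divide_distrib[symmetric] discrete_parseval[OF assms(1)])
  also have "\<dots> \<le> (real M * real (2 * N)) / (4 * t\<^sup>2 * (real N ^ 3 / 3))"
  proof (intro frac_le mult_left_mono W mult_nonneg_nonneg mult_pos_pos)
    \<comment> \<open>The index 0 contributes 0 by truncated subtraction, which leaves 2N
      differences of modulus at most 1.\<close>
    have "(\<Sum>n\<le>2*N. (tent N n - tent N (n - 1))\<^sup>2) = (\<Sum>n\<in>{1..2*N}. (tent N n - tent N (n - 1))\<^sup>2)"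
      by (intro sum.mono_neutral_right) (auto simp: tent_def not_le)
    also have "\<dots> \<le> (\<Sum>n\<in>{1..2*N}. 1)"
    proof (intro sum_mono)
      fix n assume "n \<in> {1..2*N}"
      then have "\<bar>tent N n - tent N (n - 1)\<bar> \<le> 1"
        by (auto simp: tent_def min_def)
      then show "(tent N n - tent N (n - 1))\<^sup>2 \<le> 1" by (simp add: abs_square_le_1)
    qed
    finally show "(\<Sum>n\<le>2*N. (tent N n - tent N (n - 1))\<^sup>2) \<le> real (2 * N)" by simp
  qed (use assms N3 in auto)
  also have "\<dots> = real M * ((3/2) / (real N * t)\<^sup>2)"
    using assms by (simp add: field_simps power2_eq_square power3_eq_cube)
  also have "\<dots> \<le> real M * (2 / (real N * t)\<^sup>2)"
    by (intro mult_left_mono divide_right_mono) auto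
  finally show ?thesis .
qed

subsection \<open>Smoothed indicators of intervals on the circle\<close>

definition grid_ball :: "nat \<Rightarrow> real \<Rightarrow> nat set" where
  "grid_ball M \<rho> = {i. i < M \<and> int_dist (real i / real M) \<le> \<rho>}"

lemma finite_grid_ball [simp]: "finite (grid_ball M \<rho>)"
  by (rule finite_subset[of _ "{..<M}"]) (auto simp: grid_ball_def)

lemma int_dist_one_minus: "int_dist (1 - y) = int_dist y"
  using int_dist_of_int_diff[of 1 y] by simp

text \<open>With F the floor of \<rho> M, the points lie in 0, ..., F or in their reflections M - 1,
  ..., M - F near the other end: at most 2F + 1 indices.\<close>

lemma card_grid_ball_le:
  assumes "0 \<le> \<rho>" "M > 0"
  shows "real (card (grid_ball M \<rho>)) \<le> 2 * \<rho> * real M + 1"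
proof -
  let ?F = "nat \<lfloor>\<rho> * real M\<rfloor>"
  have F: "real ?F \<le> \<rho> * real M" using assms by simp
  have "grid_ball M \<rho> \<subseteq> {..?F} \<union> (\<lambda>i. M - i) ` {1..?F}"
  proof
    fix i assume i: "i \<in> grid_ball M \<rho>"
    then have iM: "i < M" and d: "int_dist (real i / real M) \<le> \<rho>" by (auto simp: grid_ball_def)
    show "i \<in> {..?F} \<union> (\<lambda>i. M - i) ` {1..?F}"
    proof (cases "real i / real M \<le> 1/2")
      case True
      then have "int_dist (real i / real M) = real i / real M" by (intro int_dist_eq_self) auto
      with d have "real i / real M \<le> \<rho>" by linarith
      then have "real i \<le> \<rho> * real M" using assms by (simp add: field_simps)
      then have "i \<le> ?F" by (simp add: le_nat_floor)
      then show ?thesis by simp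
    next
      case False
      then have "int_dist (1 - real i / real M) = 1 - real i / real M"
        using iM by (intro int_dist_eq_self) (auto simp: field_simps)
      with d have "1 - real i / real M \<le> \<rho>" by (simp add: int_dist_one_minus)
      then have "real M - real i \<le> \<rho> * real M" using assms by (simp add: field_simps)
      then have "real (M - i) \<le> \<rho> * real M" using iM by (simp add: of_nat_diff)
      then have "M - i \<le> ?F" by (rule le_nat_floor)
      then have "M - i \<in> {1..?F}" using iM by simp
      moreover have "i = M - (M - i)" using iM by simp
      ultimately show ?thesis by blast
    qed
  qed
  then have "card (grid_ball M \<rho>) \<le> card ({..?F} \<union> (\<lambda>i. M - i) ` {1..?F})"
    by (intro card_mono) auto
  also have "\<dots> \<le> card {..?F} + card ((\<lambda>i. M - i) ` {1..?F})" by (rule card_Un_le)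
  also have "\<dots> \<le> Suc ?F + ?F" using card_image_le[of "{1..?F}" "\<lambda>i. M - i"] by simp
  finally show ?thesis using F by linarith
qed

text \<open>For \<rho> < 1/2 one has 2F < M, so the two runs near 0 and near \<open>M\<close> are
  disjoint and contribute the full 2F + 1 indices.\<close>

lemma card_grid_ball_ge:
  assumes "0 \<le> \<rho>" "\<rho> < 1/2" "M > 0"
  shows "2 * \<rho> * real M - 1 \<le> real (card (grid_ball M \<rho>))"
proof -
  let ?F = "nat \<lfloor>\<rho> * real M\<rfloor>"
  have F: "real ?F \<le> \<rho> * real M" "\<rho> * real M < real ?F + 1" using assms by auto
  have "\<rho> * real M < real M / 2" using assms by simp
  then have "2 * real ?F < real M" using F by linarith
  then have F2: "2 * ?F < M" by linarith
  have "{..?F} \<union> (\<lambda>i. M - i) ` {1..?F} \<subseteq> grid_ball M \<rho>"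
  proof
    fix i assume "i \<in> {..?F} \<union> (\<lambda>i. M - i) ` {1..?F}"
    then consider "i \<le> ?F" | k where "i = M - k" "1 \<le> k" "k \<le> ?F" by auto
    then show "i \<in> grid_ball M \<rho>"
    proof cases
      case 1
      then have "real i \<le> \<rho> * real M" using F(1) by linarith
      then have "real i / real M \<le> \<rho>" using assms by (simp add: field_simps)
      then show ?thesis
        using 1 F2 int_dist_le[of "real i / real M" 0] by (auto simp: grid_ball_def)
    next
      case 2
      then have "real k \<le> \<rho> * real M" using F(1) by linarith
      then have "real k / real M \<le> \<rho>" using assms by (simp add: field_simps)
      moreover have "real i / real M = 1 - real k / real M"
        using 2 F2 assms by (simp add: of_nat_diff field_simps)
      ultimately show ?thesis
        using 2 F2 int_dist_le[of "real k / real M" 0]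
          by (auto simp: grid_ball_def int_dist_one_minus)
    qed
  qed
  then have "card ({..?F} \<union> (\<lambda>i. M - i) ` {1..?F}) \<le> card (grid_ball M \<rho>)"
    by (intro card_mono) auto
  moreover have "card ({..?F} \<union> (\<lambda>i. M - i) ` {1..?F}) = card {..?F} + card ((\<lambda>i. M - i) ` {1..?F})"
    using F2 by (intro card_Un_disjoint) auto
  moreover have "card ((\<lambda>i. M - i) ` {1..?F}) = ?F"
    using F2 by (subst card_image) (auto simp: inj_on_def)
  ultimately have "2 * ?F + 1 \<le> card (grid_ball M \<rho>)" by simp
  then show ?thesis using F(2) by linarith
qed

text \<open>The grid convolution of the indicator of the interval of radius \<rho> with the Jackson
  kernel: a smoothed indicator.\<close>

definition plateau :: "nat \<Rightarrow> nat \<Rightarrow> real \<Rightarrow> real \<Rightarrow> real" where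
  "plateau M N \<rho> x = (\<Sum>i\<in>grid_ball M \<rho>. jackson N (x - real i / real M)) / real M"

lemma plateau_nonneg: "0 \<le> plateau M N \<rho> x"
  by (auto simp: plateau_def intro!: divide_nonneg_nonneg sum_nonneg jackson_nonneg)

lemma plateau_le_1:
  assumes "2 * N < M" "N \<ge> 1"
  shows "plateau M N \<rho> x \<le> 1"
proof -
  have "(\<Sum>i\<in>grid_ball M \<rho>. jackson N (x - real i / real M))
    \<le> (\<Sum>i<M. jackson N (x - real i / real M))"
    by (intro sum_mono2) (auto simp: grid_ball_def jackson_nonneg)
  then show ?thesis using assms by (simp add: plateau_def sum_jackson)
qed

text \<open>Every grid point of the interval is at distance at least \<open>t\<close> from
  \<open>x\<close>, so only the tail of the kernel contributes.\<close>

lemma plateau_outside: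
  assumes "2 * N < M" "N \<ge> 1" "t > 0" "\<rho> + t \<le> int_dist x"
  shows "plateau M N \<rho> x \<le> 2 / (real N * t)\<^sup>2"
proof -
  have "(\<Sum>i\<in>grid_ball M \<rho>. jackson N (x - real i / real M)) \<le> real M * (2 / (real N * t)\<^sup>2)"
  proof (rule sum_jackson_tail[OF assms(1-3)])
    fix i assume "i \<in> grid_ball M \<rho>"
    then have "int_dist (real i / real M) \<le> \<rho>" by (simp add: grid_ball_def)
    then show "t \<le> int_dist (x - real i / real M)"
      using int_dist_triangle[of "x - real i / real M" "real i / real M"] assms(4) by simp
  qed (auto simp: grid_ball_def)
  then show ?thesis using assms(1) by (simp add: plateau_def field_simps)
qed

text \<open>The total mass is 1, and the grid points outside the interval are at distance at least
  \<open>t\<close> from \<open>x\<close>, so only a tail is lost.\<close>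

lemma plateau_inside:
  assumes "2 * N < M" "N \<ge> 1" "t > 0" "int_dist x \<le> \<rho> - t"
  shows "1 - 2 / (real N * t)\<^sup>2 \<le> plateau M N \<rho> x"
proof -
  have "(\<Sum>i\<in>{..<M} - grid_ball M \<rho>. jackson N (x - real i / real M))
    \<le> real M * (2 / (real N * t)\<^sup>2)"
  proof (rule sum_jackson_tail[OF assms(1-3)])
    fix i assume "i \<in> {..<M} - grid_ball M \<rho>"
    then have "\<rho> < int_dist (real i / real M)" by (auto simp: grid_ball_def)
    then show "t \<le> int_dist (x - real i / real M)"
      using int_dist_triangle[of "- (x - real i / real M)" "x"] assms(4) int_dist_minus[of "x
        - real i / real M"]
      by (simp del: minus_diff_eq)
  qed auto
  moreover have "(\<Sum>i<M. jackson N (x - real i / real M)) =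
      (\<Sum>i\<in>{..<M} - grid_ball M \<rho>. jackson N (x - real i / real M)) + (\<Sum>i\<in>grid_ball M \<rho>. jackson N (x
        - real i / real M))"
    by (intro sum.subset_diff) (auto simp: grid_ball_def)
  ultimately have "real M - real M * (2 / (real N * t)\<^sup>2)
    \<le> (\<Sum>i\<in>grid_ball M \<rho>. jackson N (x - real i / real M))"
    using sum_jackson[OF assms(1,2), of x] by linarith
  then have "real M * (1 - 2 / (real N * t)\<^sup>2)
    \<le> (\<Sum>i\<in>grid_ball M \<rho>. jackson N (x - real i / real M))"
    by (simp add: right_diff_distrib)
  then show ?thesis using assms(1) by (simp add: plateau_def pos_le_divide_eq mult.commute)
qed

text \<open>The squared modulus of \<open>tent_poly\<close> has frequencies n - m in [-2N, 2N];
  translating by grid points changes only the coefficients.\<close>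

lemma trig_poly_plateau:
  assumes "2 * N \<le> D"
  shows "\<exists>c. trig_poly D c (plateau M N \<rho>)"
proof (rule trig_polyI[where S = "grid_ball M \<rho> \<times> {..2*N} \<times> {..2*N}"
      and \<phi> = "\<lambda>(i,n,m). int n - int m"
      and b = "\<lambda>(i,n,m). of_real (tent N n * tent N m / (tent_norm2 N * real M)) * ef (of_int (int m
        - int n) * (real i / real M))"])
  fix x
  let ?y = "\<lambda>i. x - real i / real M"
  let ?S = "grid_ball M \<rho>" and ?w = "tent_norm2 N * real M"
  have *: "ef (real n * ?y i) * ef (- (real m * ?y i))
    = ef (of_int (int m - int n) * (real i / real M)) * ef (of_int (int n - int m) * x)" for n m i
    unfolding ef_add[symmetric]
      by (rule arg_cong[where f = ef]) (simp add: algebra_simps diff_divide_distrib)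
  have "complex_of_real (plateau M N \<rho> x)
    = (\<Sum>i\<in>?S. of_real ((norm (tent_poly N (?y i)))\<^sup>2) / of_real ?w)"
    by (simp add: plateau_def jackson_def sum_divide_distrib)
  also have "\<dots> = (\<Sum>i\<in>?S. \<Sum>n\<le>2*N. \<Sum>m\<le>2*N. (of_real (tent N n * tent N m / ?w) * ef (of_int (int m
    - int n) * (real i / real M))) * ef (of_int (int n - int m) * x))"
  proof (intro sum.cong[OF refl])
    fix i
    have "complex_of_real ((norm (tent_poly N (?y i)))\<^sup>2) / of_real ?w
       = (\<Sum>n\<le>2*N. of_real (tent N n) * ef (real n * ?y i)) * (\<Sum>m\<le>2*N. of_real (tent N m)
       * ef (- (real m * ?y i))) / of_real ?w"
      by (simp only: tent_poly_def complex_norm_square cnj_sum complex_cnj_mult complex_cnj_complex_of_real ef_minus)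
    also have "\<dots> = (\<Sum>n\<le>2*N. \<Sum>m\<le>2*N. of_real (tent N n * tent N m / ?w) * (ef (real n * ?y i)
      * ef (- (real m * ?y i))))"
      unfolding sum_product sum_divide_distrib by (intro sum.cong refl) simp
    finally show "complex_of_real ((norm (tent_poly N (?y i)))\<^sup>2) / of_real ?w
       = (\<Sum>n\<le>2*N. \<Sum>m\<le>2*N. (of_real (tent N n * tent N m / ?w) * ef (of_int (int m - int n)
       * (real i / real M))) * ef (of_int (int n - int m) * x))"
      unfolding * by (simp only: mult.assoc)
  qed
  finally show "complex_of_real (plateau M N \<rho> x) = (\<Sum>i\<in>?S \<times> {..2*N} \<times> {..2*N}.
        (case i of (i,n,m) \<Rightarrow> of_real (tent N n * tent N m / ?w) * ef (of_int (int m - int n)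
          * (real i / real M)))
          * ef (of_int (case i of (i,n,m) \<Rightarrow> int n - int m) * x))"
    by (simp add: sum.cartesian_product case_prod_beta)
qed (use assms in auto)

text \<open>The mean is exactly the proportion of grid points in the interval: after exchanging
  sums, each translate of the kernel has mean 1.\<close>

lemma dmean_plateau_le:
  assumes "2 * N < M" "N \<ge> 1" "0 \<le> \<rho>"
  shows "dmean M (plateau M N \<rho>) \<le> 2 * \<rho> + 1 / real M"
proof -
  \<comment> \<open>Evenness swaps the summation point and the centre, giving the form in which
    \<open>sum_jackson\<close> applies.\<close>
  have sym: "jackson N (- y) = jackson N y" for y
  proof -
    have "tent_poly N (- y) = cnj (tent_poly N y)"
      unfolding tent_poly_def by (simp add: ef_minus)
    then show ?thesis by (simp add: jackson_def)
  qed
  have "(\<Sum>k<M. \<Sum>i\<in>grid_ball M \<rho>. jackson N (real k / real M - real i / real M))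
      = (\<Sum>i\<in>grid_ball M \<rho>. \<Sum>k<M. jackson N (real i / real M - real k / real M))"
    by (subst sum.swap) (intro sum.cong refl, metis sym minus_diff_eq)
  also have "\<dots> = real (card (grid_ball M \<rho>)) * real M"
    using assms by (simp add: sum_jackson)
  finally have "dmean M (plateau M N \<rho>) = real (card (grid_ball M \<rho>)) / real M"
    using assms(1) by (simp add: dmean_def plateau_def flip: sum_divide_distrib)
  also have "\<dots> \<le> (2 * \<rho> * real M + 1) / real M"
    using assms by (intro divide_right_mono card_grid_ball_le) auto
  also have "\<dots> = 2 * \<rho> + 1 / real M" using assms(1) by (simp add: field_simps)
  finally show ?thesis .
qed

text \<open>Only the grid points within \<rho> - t of 0 are kept, where the plateau is at least one
  minus the tail. The square is needed for the leading term of the minorant.\<close>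

lemma dmean_plateau_square_ge:
  assumes "2 * N < M" "N \<ge> 1" "t > 0" "t \<le> \<rho>" "\<rho> \<le> 1/2" "2 / (real N * t)\<^sup>2 \<le> 1"
  shows "(1 - 2 / (real N * t)\<^sup>2)\<^sup>2 * (2 * (\<rho> - t) - 1 / real M)
    \<le> dmean M (\<lambda>x. plateau M N \<rho> x * plateau M N \<rho> x)"
proof -
  let ?\<tau> = "2 / (real N * t)\<^sup>2"
  have "(1 - ?\<tau>)\<^sup>2 * (2 * (\<rho> - t) - 1 / real M) * real M = (1 - ?\<tau>)\<^sup>2 * (2 * (\<rho> - t) * real M - 1)"
    using assms(1) by (simp add: field_simps)
  also have "\<dots> \<le> (1 - ?\<tau>)\<^sup>2 * real (card (grid_ball M (\<rho> - t)))"
    using assms by (intro mult_left_mono card_grid_ball_ge) auto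
  also have "\<dots> = (\<Sum>i\<in>grid_ball M (\<rho> - t). (1 - ?\<tau>)\<^sup>2)" by simp
  also have "\<dots> \<le> (\<Sum>i\<in>grid_ball M (\<rho> - t). (plateau M N \<rho> (real i / real M))\<^sup>2)"
    using assms by (intro sum_mono power_mono plateau_inside) (auto simp: grid_ball_def)
  also have "\<dots> \<le> (\<Sum>i<M. (plateau M N \<rho> (real i / real M))\<^sup>2)"
    by (intro sum_mono2) (auto simp: grid_ball_def)
  finally show ?thesis using assms(1) by (simp add: dmean_def pos_le_divide_eq power2_eq_square)
qed

subsection \<open>Dyadic pigeonhole for reciprocal products\<close>

text \<open>Pigeonhole: distinct elements have distinct values of the floor of f / w.\<close>

lemma card_separated_le:
  fixes f :: "'x \<Rightarrow> real"
  assumes "w > 0" "\<And>x. x \<in> X \<Longrightarrow> f x \<in> {0..b}" "b \<ge> 0"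
    and "\<And>x y. \<lbrakk>x \<in> X; y \<in> X; x \<noteq> y\<rbrakk> \<Longrightarrow> w \<le> \<bar>f x - f y\<bar>"
  shows "real (card X) \<le> b / w + 1"
proof -
  let ?\<phi> = "\<lambda>x. nat \<lfloor>f x / w\<rfloor>"
  have "inj_on ?\<phi> X"
  proof (rule inj_onI, rule ccontr)
    fix x y assume xy: "x \<in> X" "y \<in> X" "?\<phi> x = ?\<phi> y" "x \<noteq> y"
    have "0 \<le> \<lfloor>f x / w\<rfloor>" "0 \<le> \<lfloor>f y / w\<rfloor>" using assms(1,2) xy by auto
    then have "\<lfloor>f x / w\<rfloor> = \<lfloor>f y / w\<rfloor>" using xy(3) eq_nat_nat_iff by blast
    then have "\<bar>f x / w - f y / w\<bar> < 1" by linarith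
    then have "\<bar>f x - f y\<bar> / w < 1" using assms(1) by (simp flip: diff_divide_distrib)
    then show False using assms(1) assms(4)[OF xy(1,2,4)] by simp
  qed
  moreover have "?\<phi> ` X \<subseteq> {..nat \<lfloor>b / w\<rfloor>}"
    using assms(1,2) by (auto intro!: nat_mono floor_mono divide_right_mono)
  ultimately have "card X \<le> card {..nat \<lfloor>b / w\<rfloor>}" by (intro card_inj_on_le) auto
  moreover have "real (nat \<lfloor>b / w\<rfloor>) \<le> b / w" using assms by simp
  ultimately show ?thesis by simp
qed

text \<open>Pigeonhole along one coordinate \<open>v\<close>. Inside the box all other coordinates
  differ by at most \<beta> u, so the separation of the product forces the
  \<open>v\<close>-coordinates apart by \<kappa> / W. This gives at most V / \<kappa> + 1 <= 2 V /
  \<kappa> points, each contributing at most 2^r / V; the volume cancels, so the bound does not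
  depend on the shape of the box.\<close>

lemma sum_inverse_prod_box_le:
  fixes z :: "'x \<Rightarrow> 'r::finite \<Rightarrow> real" and \<beta> :: "'r \<Rightarrow> real"
  assumes "finite Y" "0 < \<kappa>" "\<And>u. 0 < \<beta> u"
    and box: "\<And>x u. x \<in> Y \<Longrightarrow> \<beta> u / 2 \<le> \<bar>z x u\<bar> \<and> \<bar>z x u\<bar> \<le> \<beta> u"
    and sgn: "\<And>x y u. \<lbrakk>x \<in> Y; y \<in> Y\<rbrakk> \<Longrightarrow> 0 \<le> z x u \<longleftrightarrow> 0 \<le> z y u"
    and low: "\<And>x. x \<in> Y \<Longrightarrow> \<kappa> \<le> (\<Prod>u\<in>UNIV. \<bar>z x u\<bar>)"
    and sep: "\<And>x y. \<lbrakk>x \<in> Y; y \<in> Y; x \<noteq> y\<rbrakk> \<Longrightarrow> \<kappa> \<le> (\<Prod>u\<in>UNIV. \<bar>z x u - z y u\<bar>)"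
  shows "(\<Sum>x\<in>Y. \<Prod>u\<in>UNIV. 1 / \<bar>z x u\<bar>) \<le> 2 * 2 ^ CARD('r) / \<kappa>"
proof (cases "Y = {}")
  case False
  then obtain x0 where x0: "x0 \<in> Y" by auto
  define V where "V = (\<Prod>u\<in>UNIV. \<beta> u)"
  have V: "0 < V" unfolding V_def by (intro prod_pos) (auto simp: assms)
  have "\<kappa> \<le> V" using low[OF x0] unfolding V_def
    by (rule order_trans) (intro prod_mono, use box[OF x0] in auto)
  obtain v :: 'r where True by simp
  define W where "W = (\<Prod>u\<in>UNIV - {v}. \<beta> u)"
  have W: "0 < W" unfolding W_def by (intro prod_pos) (auto simp: assms)
  have VW: "V = \<beta> v * W" unfolding V_def W_def by (rule prod.remove) auto
  have "real (card Y) \<le> \<beta> v / (\<kappa> / W) + 1"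
  proof (rule card_separated_le[of _ _ "\<lambda>x. \<bar>z x v\<bar>"])
    fix x y assume xy: "x \<in> Y" "y \<in> Y" "x \<noteq> y"
    \<comment> \<open>Equal signs make differences of coordinates equal to differences of absolute
      values; this is why boxes are also sorted by sign.\<close>
    have eq: "\<bar>z x u - z y u\<bar> = \<bar>\<bar>z x u\<bar> - \<bar>z y u\<bar>\<bar>" for u
      using sgn[OF xy(1,2), of u] by linarith
    have "\<kappa> \<le> \<bar>z x v - z y v\<bar> * (\<Prod>u\<in>UNIV-{v}. \<bar>z x u - z y u\<bar>)"
      using sep[OF xy] by (simp add: prod.remove[of UNIV v])
    also have "\<dots> \<le> \<bar>z x v - z y v\<bar> * W"
      unfolding W_def
    proof (intro mult_left_mono prod_mono conjI)
      fix u
      show "\<bar>z x u - z y u\<bar> \<le> \<beta> u"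
        unfolding eq using box[OF xy(1), of u] box[OF xy(2), of u] by linarith
    qed auto
    finally show "\<kappa> / W \<le> \<bar>\<bar>z x v\<bar> - \<bar>z y v\<bar>\<bar>"
      using W by (simp add: eq[symmetric] pos_divide_le_eq)
  next
    show "0 < \<kappa> / W" using assms(2) W by simp
    show "0 \<le> \<beta> v" using assms(3)[of v] by simp
    show "\<bar>z x v\<bar> \<in> {0..\<beta> v}" if "x \<in> Y" for x using box[OF that, of v] by simp
  qed
  also have "\<dots> = V / \<kappa> + 1" by (simp add: VW)
  also have "\<dots> \<le> 2 * V / \<kappa>" using \<open>\<kappa> \<le> V\<close> assms(2) by (simp add: field_simps)
  finally have card: "real (card Y) \<le> 2 * V / \<kappa>" .
  have "(\<Sum>x\<in>Y. \<Prod>u\<in>UNIV. 1 / \<bar>z x u\<bar>) \<le> (\<Sum>x\<in>Y. \<Prod>u\<in>UNIV. 2 / \<beta> u)"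
  proof (intro sum_mono prod_mono conjI)
    fix x u assume "x \<in> Y"
    then have "\<beta> u / 2 \<le> \<bar>z x u\<bar>" using box by blast
    then have "1 / \<bar>z x u\<bar> \<le> 1 / (\<beta> u / 2)" using assms(3)[of u]
      by (intro divide_left_mono) (auto simp: zero_less_mult_iff)
    then show "1 / \<bar>z x u\<bar> \<le> 2 / \<beta> u" by simp
  qed auto
  also have "\<dots> = real (card Y) * (2 ^ CARD('r) / V)"
    by (simp add: prod_dividef V_def)
  also have "\<dots> \<le> 2 * V / \<kappa> * (2 ^ CARD('r) / V)"
    using card V by (intro mult_right_mono) auto
  also have "\<dots> = 2 * 2 ^ CARD('r) / \<kappa>" using V by simp
  finally show ?thesis .
qed (use assms(2) in simp)

lemma dyadic_bracket:
  fixes y :: real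
  assumes "0 < y" "y \<le> 1"
  defines "k \<equiv> nat \<lfloor>log 2 (1 / y)\<rfloor>"
  shows "1 / 2 ^ k / 2 \<le> y" "y \<le> 1 / 2 ^ k"
proof -
  have "0 \<le> log 2 (1 / y)" using assms by simp
  then have k: "real k \<le> log 2 (1 / y)" "log 2 (1 / y) < real k + 1" unfolding k_def by auto
  have "2 powr real k \<le> 1 / y" using k(1) assms(1,2) by (subst le_log_iff[symmetric]) auto
  then show "y \<le> 1 / 2 ^ k" using assms(1) by (simp add: powr_realpow field_simps)
  have "1 / y < 2 powr (real k + 1)" using k(2) assms(1,2) by (subst log_less_iff[symmetric]) auto
  then have "1 / y < 2 * 2 ^ k" by (simp add: powr_add powr_realpow)
  then show "1 / 2 ^ k / 2 \<le> y" using assms(1) by (simp add: field_simps)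
qed

text \<open>Points are sorted by the sign and the dyadic size of each coordinate. The previous box
  bound is uniform, so only the number of boxes matters, and it is a power of a logarithm.\<close>

lemma sum_inverse_prod_int_dist_le:
  fixes \<theta> :: "'x \<Rightarrow> 'r::finite \<Rightarrow> real"
  assumes "finite X" "0 < \<kappa>" "\<kappa> \<le> 1"
    and low: "\<And>x. x \<in> X \<Longrightarrow> \<kappa> \<le> (\<Prod>u\<in>UNIV. int_dist (\<theta> x u))"
    and sep: "\<And>x y. \<lbrakk>x \<in> X; y \<in> X; x \<noteq> y\<rbrakk> \<Longrightarrow> \<kappa> \<le> (\<Prod>u\<in>UNIV. int_dist (\<theta> x u - \<theta> y u))"
  shows "(\<Sum>x\<in>X. \<Prod>u\<in>UNIV. 1 / int_dist (\<theta> x u))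
    \<le> 2 * 4 ^ CARD('r) * (log 2 (1 / \<kappa>) + 1) ^ CARD('r) / \<kappa>"
proof -
  \<comment> \<open>The signed representative modulo 1 in [-1/2, 1/2].\<close>
  define z where "z x u = \<theta> x u - of_int (round (\<theta> x u))" for x u
  have id_z: "int_dist (\<theta> x u) = \<bar>z x u\<bar>" for x u by (simp add: z_def int_dist_eq_abs_round)
  define L where "L = nat \<lfloor>log 2 (1 / \<kappa>)\<rfloor>"
  define k where "k x u = nat \<lfloor>log 2 (1 / \<bar>z x u\<bar>)\<rfloor>" for x u
  define q where "q x = (\<lambda>u. (0 \<le> z x u, k x u))" for x
  have z1: "\<bar>z x u\<bar> \<le> 1" for x u using int_dist_le_half[of "\<theta> x u"] id_z[of x u] by linarith
  \<comment> \<open>All factors are at most 1, so the lower bound for the product passes to each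
    factor and limits the dyadic exponents to 0, ..., L.\<close>
  have zk: "\<kappa> \<le> \<bar>z x u\<bar>" if "x \<in> X" for x u
  proof -
    have "\<kappa> \<le> \<bar>z x u\<bar> * (\<Prod>u\<in>UNIV-{u}. \<bar>z x u\<bar>)"
      using low[OF that] by (simp add: id_z prod.remove[of UNIV u])
    also have "\<dots> \<le> \<bar>z x u\<bar> * 1" by (intro mult_left_mono prod_le_1) (auto simp: z1)
    finally show ?thesis by simp
  qed
  define B :: "('r \<Rightarrow> bool \<times> nat) set" where "B = PiE UNIV (\<lambda>_. UNIV \<times> {..L})"
  have finB: "finite B" unfolding B_def by (intro finite_PiE) auto
  have qB: "q ` X \<subseteq> B"
  proof -
    have "k x u \<le> L" if "x \<in> X" for x u
      unfolding k_def L_def using zk[OF that, of u] assms(2)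
      by (intro nat_mono floor_mono) (auto intro!: divide_left_mono mult_pos_pos)
    then show ?thesis by (auto simp: B_def q_def)
  qed
  have "(\<Sum>x\<in>X. \<Prod>u\<in>UNIV. 1 / int_dist (\<theta> x u)) = (\<Sum>b\<in>B. \<Sum>x\<in>{x\<in>X. q x = b}. \<Prod>u\<in>UNIV. 1 / \<bar>z x u\<bar>)"
    unfolding id_z by (rule sum.group[symmetric, OF assms(1) finB qB])
  also have "\<dots> \<le> (\<Sum>b\<in>B. 2 * 2 ^ CARD('r) / \<kappa>)"
  proof (intro sum_mono)
    fix b
    show "(\<Sum>x\<in>{x\<in>X. q x = b}. \<Prod>u\<in>UNIV. 1 / \<bar>z x u\<bar>) \<le> 2 * 2 ^ CARD('r) / \<kappa>"
    proof (rule sum_inverse_prod_box_le[where \<beta> = "\<lambda>u. 1 / 2 ^ snd (b u)"])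
      fix x u assume x: "x \<in> {x\<in>X. q x = b}"
      then have "snd (b u) = k x u" by (auto simp: q_def)
      moreover have "0 < \<bar>z x u\<bar>" using zk[of x u] x assms(2) by auto
      ultimately show "1 / 2 ^ snd (b u) / 2 \<le> \<bar>z x u\<bar> \<and> \<bar>z x u\<bar> \<le> 1 / 2 ^ snd (b u)"
        using dyadic_bracket[of "\<bar>z x u\<bar>"] z1 unfolding k_def by auto
    next
      fix x y u assume "x \<in> {x\<in>X. q x = b}" "y \<in> {x\<in>X. q x = b}"
      then have "q x u = q y u" by simp
      then show "(0 \<le> z x u) = (0 \<le> z y u)" by (simp add: q_def)
    next
      fix x assume "x \<in> {x\<in>X. q x = b}"
      then show "\<kappa> \<le> (\<Prod>u\<in>UNIV. \<bar>z x u\<bar>)" using low[of x] by (simp add: id_z)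
    next
      fix x y assume xy: "x \<in> {x\<in>X. q x = b}" "y \<in> {x\<in>X. q x = b}" "x \<noteq> y"
      then have "\<kappa> \<le> (\<Prod>u\<in>UNIV. int_dist (\<theta> x u - \<theta> y u))" using sep by auto
      \<comment> \<open>The two differences agree modulo 1, so the distance to the nearest integer
        is bounded by the real one.\<close>
      also have "\<dots> \<le> (\<Prod>u\<in>UNIV. \<bar>z x u - z y u\<bar>)"
      proof (intro prod_mono conjI int_dist_nonneg)
        fix u
        show "int_dist (\<theta> x u - \<theta> y u) \<le> \<bar>z x u - z y u\<bar>"
          using int_dist_le[of "\<theta> x u - \<theta> y u" "round (\<theta> x u) - round (\<theta> y u)"]
          by (simp add: z_def algebra_simps)
      qed
      finally show "\<kappa> \<le> (\<Prod>u\<in>UNIV. \<bar>z x u - z y u\<bar>)" .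
    qed (use assms in auto)
  qed
  also have "\<dots> = (2 * (real L + 1)) ^ CARD('r) * (2 * 2 ^ CARD('r) / \<kappa>)"
    by (simp add: B_def card_PiE card_cartesian_product add.commute)
  also have "\<dots> \<le> (2 * (log 2 (1 / \<kappa>) + 1)) ^ CARD('r) * (2 * 2 ^ CARD('r) / \<kappa>)"
  proof (intro mult_right_mono power_mono mult_left_mono add_right_mono)
    have "0 \<le> log 2 (1 / \<kappa>)" using assms(2,3) by simp
    then show "real L \<le> log 2 (1 / \<kappa>)" unfolding L_def by simp
  qed (use assms in auto)
  also have "\<dots> = 2 * 4 ^ CARD('r) * (log 2 (1 / \<kappa>) + 1) ^ CARD('r) / \<kappa>"
  proof -
    have "(4::real) ^ CARD('r) = 2 ^ CARD('r) * 2 ^ CARD('r)" by (simp flip: power_mult_distrib)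
    then show ?thesis unfolding power_mult_distrib by simp
  qed
  finally show ?thesis .
qed

subsection \<open>Counting points with trigonometric polynomials\<close>

text \<open>Expanding the product over \<open>k\<close> gives a sum over frequency vectors
  \<open>h\<close>, and for each \<open>h\<close> the sum over \<open>a\<close> factors into
  geometric sums, one per row. The zero frequency is the main term; each other one is bounded by m^c
  times the reciprocals of the distances.\<close>

lemma sum_prod_trig_poly:
  fixes A :: "'r::finite \<Rightarrow> 'c::finite \<Rightarrow> real" and m :: real
  defines "\<theta> \<equiv> \<lambda>(h :: 'c \<Rightarrow> int) u. \<Sum>k\<in>UNIV. of_int (h k) * A u k"
    and "H \<equiv> \<lambda>D. (UNIV :: 'c set) \<rightarrow>\<^sub>E {-int D..int D}"
  assumes "trig_poly D c g" and "\<And>j. \<bar>j\<bar> \<le> int D \<Longrightarrow> norm (c j) \<le> m" and "c 0 = of_real m"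
    and pos: "\<And>h u. \<lbrakk>h \<in> H D; h \<noteq> (\<lambda>_. 0)\<rbrakk> \<Longrightarrow> 0 < int_dist (\<theta> h u)"
  shows "\<bar>(\<Sum>a\<in>(UNIV :: 'r set) \<rightarrow>\<^sub>E {1..Q}. \<Prod>k\<in>UNIV. g (\<Sum>u\<in>UNIV. real (a u) * A u k)) - m ^ CARD('c)
    * real Q ^ CARD('r)\<bar>
    \<le> m ^ CARD('c) * (\<Sum>h\<in>H D - {\<lambda>_. 0}. \<Prod>u\<in>UNIV. 1 / int_dist (\<theta> h u))"
proof -
  let ?P = "(UNIV :: 'r set) \<rightarrow>\<^sub>E {1..Q}"
  let ?y = "\<lambda>a k. \<Sum>u\<in>UNIV. real (a u) * A u k"
  define G where "G h = (\<Prod>k\<in>UNIV. c (h k)) * (\<Prod>u\<in>UNIV. \<Sum>n=1..Q. ef (real n * \<theta> h u))" for h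
  have m0: "0 \<le> m" using assms(4)[of 0] norm_ge_zero[of "c 0"] by linarith
  have finH: "finite (H D)" unfolding H_def by (intro finite_PiE) auto
  have zH: "(\<lambda>_. 0) \<in> H D" by (auto simp: H_def)
  have "complex_of_real (\<Sum>a\<in>?P. \<Prod>k\<in>UNIV. g (?y a k))
    = (\<Sum>a\<in>?P. \<Prod>k\<in>UNIV. \<Sum>j=-int D..int D. c j * ef (of_int j * ?y a k))"
    using assms(3) by (simp add: trig_poly_def)
  also have "\<dots> = (\<Sum>a\<in>?P. \<Sum>h\<in>H D. \<Prod>k\<in>UNIV. c (h k) * ef (of_int (h k) * ?y a k))"
    unfolding H_def by (intro sum.cong refl prod_sum_PiE) auto
  also have "\<dots> = (\<Sum>h\<in>H D. \<Sum>a\<in>?P. \<Prod>k\<in>UNIV. c (h k) * ef (of_int (h k) * ?y a k))"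
    by (rule sum.swap)
  also have "\<dots> = (\<Sum>h\<in>H D. G h)"
  proof (intro sum.cong[OF refl])
    fix h
    \<comment> \<open>The bilinear form is regrouped by rows, which decouples the coordinates of
      \<open>a\<close>.\<close>
    have ph: "(\<Sum>k\<in>UNIV. of_int (h k) * ?y a k) = (\<Sum>u\<in>UNIV. real (a u) * \<theta> h u)" for a
      unfolding \<theta>_def sum_distrib_left by (subst sum.swap) (simp add: mult_ac)
    have "(\<Sum>a\<in>?P. \<Prod>k\<in>UNIV. c (h k) * ef (of_int (h k) * ?y a k))
       = (\<Sum>a\<in>?P. (\<Prod>k\<in>UNIV. c (h k)) * (\<Prod>u\<in>UNIV. ef (real (a u) * \<theta> h u)))"
      unfolding prod.distrib ef_sum[symmetric] ph ..
    also have "\<dots> = G h"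
      unfolding G_def sum_distrib_left[symmetric] by (subst prod_sum_PiE) auto
    finally show "(\<Sum>a\<in>?P. \<Prod>k\<in>UNIV. c (h k) * ef (of_int (h k) * ?y a k)) = G h" .
  qed
  also have "\<dots> = G (\<lambda>_. 0) + (\<Sum>h\<in>H D - {\<lambda>_. 0}. G h)"
    by (rule sum.remove[OF finH zH])
  also have "G (\<lambda>_. 0) = complex_of_real (m ^ CARD('c) * real Q ^ CARD('r))"
    by (simp add: G_def \<theta>_def assms(5))
  finally have eq: "complex_of_real ((\<Sum>a\<in>?P. \<Prod>k\<in>UNIV. g (?y a k)) - m ^ CARD('c)
    * real Q ^ CARD('r)) = (\<Sum>h\<in>H D - {\<lambda>_. 0}. G h)"
    by simp
  have "\<bar>(\<Sum>a\<in>?P. \<Prod>k\<in>UNIV. g (?y a k)) - m ^ CARD('c) * real Q ^ CARD('r)\<bar>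
    = norm (\<Sum>h\<in>H D - {\<lambda>_. 0}. G h)"
    unfolding eq[symmetric] norm_of_real ..
  also have "\<dots> \<le> (\<Sum>h\<in>H D - {\<lambda>_. 0}. m ^ CARD('c) * (\<Prod>u\<in>UNIV. 1 / int_dist (\<theta> h u)))"
  proof (rule sum_norm_le)
    fix h assume h: "h \<in> H D - {\<lambda>_. 0}"
    have "(\<Prod>k\<in>UNIV. norm (c (h k))) \<le> (\<Prod>k\<in>(UNIV::'c set). m)"
      using h by (intro prod_mono conjI assms(4)) (auto simp: H_def PiE_iff abs_le_iff minus_le_iff)
    moreover have "(\<Prod>u\<in>UNIV. norm (\<Sum>n=1..Q. ef (real n * \<theta> h u))) \<le> (\<Prod>u\<in>UNIV. 1 / int_dist (\<theta> h u))"
      using h pos by (intro prod_mono conjI norm_sum_ef_le) auto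
    ultimately show "norm (G h) \<le> m ^ CARD('c) * (\<Prod>u\<in>UNIV. 1 / int_dist (\<theta> h u))"
      unfolding G_def norm_mult prod_norm[symmetric]
        by (intro mult_mono) (auto intro!: prod_nonneg simp: m0)
  qed
  finally show ?thesis by (simp add: sum_distrib_left)
qed

section \<open>The count as a sum over a product set, and its error term\<close>

lemma infnorm_cart_le_iff: "infnorm (x :: real ^ 'n) \<le> b \<longleftrightarrow> (\<forall>i. \<bar>x $ i\<bar> \<le> b)"
proof
  assume "infnorm x \<le> b"
  then show "\<forall>i. \<bar>x $ i\<bar> \<le> b"
    using component_le_infnorm_cart[of x] order_trans by blast
next
  assume "\<forall>i. \<bar>x $ i\<bar> \<le> b"
  then show "infnorm x \<le> b"
    unfolding infnorm_cart by (intro cSup_least) auto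
qed

lemma near_int_count_eq:
  fixes A :: "real ^ 'c ^ 'r"
  shows "near_int_count A Q \<delta>
    = card {a \<in> (UNIV :: 'r set) \<rightarrow>\<^sub>E {1..Q}. \<forall>k. int_dist (\<Sum>u\<in>UNIV. real (a u) * A $ u $ k) < \<delta>}"
    (is "_ = card ?N")
proof -
  have "int_dist_vec y < \<delta> \<longleftrightarrow> (\<forall>k. int_dist (y $ k) < \<delta>)" for y :: "real ^ 'c"
    unfolding int_dist_vec_def by (subst Max_less_iff) auto
  then have "near_int_points A Q \<delta> = {a. vec_nth a \<in> ?N}"
    by (auto simp: near_int_points_def infnorm_cart_le_iff vec_of_nat_def vector_matrix_mult_def mult_ac PiE_iff Suc_le_eq)
  moreover have "bij_betw vec_lambda ?N {a. vec_nth a \<in> ?N}"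
    by (rule bij_betwI[where g = vec_nth]) auto
  ultimately show ?thesis
    by (simp add: near_int_count_def bij_betw_same_card)
qed

text \<open>Differences of frequency vectors from \<open>H D\<close> lie in
  \<open>H (2 * D)\<close>. Hence one constant, of order D powr (- \<omega>), serves both as lower
  bound and as separation in the dyadic estimate, and D = O(1/\<delta>) turns it into powers of
  \<delta>.\<close>

lemma error_sum_le:
  fixes A :: "'r::finite \<Rightarrow> 'c::finite \<Rightarrow> real"
  defines "\<theta> \<equiv> \<lambda>(h :: 'c \<Rightarrow> int) u. \<Sum>k\<in>UNIV. of_int (h k) * A u k"
    and "H \<equiv> \<lambda>D. (UNIV :: 'c set) \<rightarrow>\<^sub>E {-int D..int D}"
  assumes "0 < \<kappa>" "0 < \<omega>" "0 < b"
    and dioph: "\<And>h E. \<lbrakk>h \<noteq> (\<lambda>_. 0); h \<in> H E\<rbrakk> \<Longrightarrow> \<kappa> \<le> real E powr \<omega> * (\<Prod>u\<in>UNIV. int_dist (\<theta> h u))"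
  shows "\<exists>C\<ge>0. \<forall>\<delta>\<in>{0<..1/2}. \<forall>D\<ge>1. real D \<le> b / \<delta> \<longrightarrow>
     (\<Sum>h\<in>H D - {\<lambda>_. 0}. \<Prod>u\<in>UNIV. 1 / int_dist (\<theta> h u)) \<le> C * \<delta> powr (- \<omega>) * ln (1 / \<delta>) ^ CARD('r)"
proof -
  \<comment> \<open>The cut-offs at 1 here and in \<open>C1\<close> keep the logarithms of 1 / K and
    of C1 nonnegative.\<close>
  define \<kappa>' where "\<kappa>' = min 1 \<kappa>"
  define C1 where "C1 = max 1 ((2 * b) powr \<omega> / \<kappa>')"
  define C2 where "C2 = (log 2 C1 + 1 + \<omega>) / ln 2"
  define C where "C = 2 * 4 ^ CARD('r) * C2 ^ CARD('r) * C1"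
  have k': "0 < \<kappa>'" "\<kappa>' \<le> 1" "\<kappa>' \<le> \<kappa>" using assms by (auto simp: \<kappa>'_def)
  have C1: "1 \<le> C1" by (simp add: C1_def)
  then have C2: "0 \<le> C2" using assms by (auto simp: C2_def)
  have bound: "(\<Sum>h\<in>H D - {\<lambda>_. 0}. \<Prod>u\<in>UNIV. 1 / int_dist (\<theta> h u))
    \<le> C * \<delta> powr (- \<omega>) * ln (1 / \<delta>) ^ CARD('r)"
    if \<delta>: "0 < \<delta>" "\<delta> \<le> 1/2" and D: "D \<ge> 1" "real D \<le> b / \<delta>" for \<delta> D
  proof -
    define K where "K = \<kappa>' / real (2 * D) powr \<omega>"
    have D2: "1 \<le> real (2 * D) powr \<omega>" using D assms by (intro ge_one_powr_ge_zero) auto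
    have K: "0 < K" "K \<le> 1" using k' D2 D by (auto simp: K_def divide_le_eq)
    have Kle: "K \<le> (\<Prod>u\<in>UNIV. int_dist (\<theta> h u))" if "h \<noteq> (\<lambda>_. 0)" "h \<in> H (2 * D)" for h
    proof -
      have "\<kappa>' \<le> real (2 * D) powr \<omega> * (\<Prod>u\<in>UNIV. int_dist (\<theta> h u))"
        using dioph[OF that] k'(3) by linarith
      then show ?thesis unfolding K_def using D D2
        by (subst pos_divide_le_eq) (auto simp: mult.commute)
    qed
    have "(\<Sum>h\<in>H D - {\<lambda>_. 0}. \<Prod>u\<in>UNIV. 1 / int_dist (\<theta> h u))
      \<le> 2 * 4 ^ CARD('r) * (log 2 (1 / K) + 1) ^ CARD('r) / K"
    proof (rule sum_inverse_prod_int_dist_le[OF _ K])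
      show "finite (H D - {\<lambda>_. 0})" unfolding H_def by (intro finite_Diff finite_PiE) auto
      show "K \<le> (\<Prod>u\<in>UNIV. int_dist (\<theta> h u))" if "h \<in> H D - {\<lambda>_. 0}" for h
        using that by (intro Kle) (auto simp: H_def PiE_iff, (smt (verit))+)
      show "K \<le> (\<Prod>u\<in>UNIV. int_dist (\<theta> h u - \<theta> h' u))"
        if "h \<in> H D - {\<lambda>_. 0}" "h' \<in> H D - {\<lambda>_. 0}" "h \<noteq> h'" for h h'
      proof -
        have "\<theta> h u - \<theta> h' u = \<theta> (\<lambda>k. h k - h' k) u" for u
          by (simp add: \<theta>_def left_diff_distrib sum_subtractf)
        moreover have "(\<lambda>k. h k - h' k) \<noteq> (\<lambda>_. 0)" using that(3) by (auto simp: fun_eq_iff)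
        moreover have "(\<lambda>k. h k - h' k) \<in> H (2 * D)"
        proof -
          have "- int D \<le> h k \<and> h k \<le> int D \<and> - int D \<le> h' k \<and> h' k \<le> int D" for k
            using that by (auto simp: H_def PiE_iff)
          then show ?thesis by (auto simp: H_def PiE_iff) (smt (verit))+
        qed
        ultimately show ?thesis using Kle by simp
      qed
    qed
    also have "\<dots> = 2 * 4 ^ CARD('r) * (log 2 (1 / K) + 1) ^ CARD('r) * (1 / K)" by simp
    also have "\<dots> \<le> 2 * 4 ^ CARD('r) * (C2 * ln (1 / \<delta>)) ^ CARD('r) * (C1 * \<delta> powr (- \<omega>))"
    proof -
      have K1: "1 / K \<le> C1 * \<delta> powr (- \<omega>)"
      proof -
        have "1 / K = real (2 * D) powr \<omega> / \<kappa>'" by (simp add: K_def)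
        also have "\<dots> \<le> (2 * b / \<delta>) powr \<omega> / \<kappa>'"
          using D k' assms(4) by (intro divide_right_mono powr_mono2) auto
        also have "\<dots> = (2 * b) powr \<omega> / \<kappa>' * \<delta> powr (- \<omega>)"
          using assms \<delta> by (simp add: powr_divide powr_minus_divide)
        also have "\<dots> \<le> C1 * \<delta> powr (- \<omega>)" by (intro mult_right_mono) (auto simp: C1_def)
        finally show ?thesis .
      qed
      \<comment> \<open>As \<delta> <= 1/2, the quotient ln (1 / \<delta>) / ln 2 is at least 1,
        which absorbs additive constants into the logarithm.\<close>
      have l2: "ln 2 \<le> ln (1 / \<delta>)" using \<delta> by (subst ln_le_cancel_iff) (auto simp: field_simps)
      then have l0: "0 \<le> ln (1 / \<delta>)" using ln_gt_zero[of "2::real"] by linarith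
      have "log 2 (1 / K) \<le> log 2 (C1 * \<delta> powr (- \<omega>))"
        using K K1 C1 \<delta> by (subst log_le_cancel_iff) auto
      also have "\<dots> = log 2 C1 + \<omega> * (ln (1 / \<delta>) / ln 2)"
        using C1 \<delta> by (simp add: log_def ln_mult_pos ln_powr ln_div add_divide_distrib diff_divide_distrib)
      finally have "log 2 (1 / K) + 1 \<le> (log 2 C1 + 1) * 1 + \<omega> * (ln (1 / \<delta>) / ln 2)" by simp
      also have "\<dots> \<le> (log 2 C1 + 1) * (ln (1 / \<delta>) / ln 2) + \<omega> * (ln (1 / \<delta>) / ln 2)"
        using l2 C1 by (intro add_right_mono mult_left_mono) auto
      also have "\<dots> = C2 * ln (1 / \<delta>)" by (simp add: C2_def field_simps)
      finally have K2: "log 2 (1 / K) + 1 \<le> C2 * ln (1 / \<delta>)" .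
      have K3: "0 \<le> log 2 (1 / K) + 1" using K by (simp add: add_nonneg_nonneg)
      show ?thesis
        using K K1 K2 K3 C2 l0 by (intro mult_mono power_mono mult_nonneg_nonneg zero_le_power) auto
    qed
    also have "\<dots> = C * \<delta> powr (- \<omega>) * ln (1 / \<delta>) ^ CARD('r)"
      by (simp add: C_def power_mult_distrib)
    finally show ?thesis .
  qed
  moreover have "C \<ge> 0" using C1 C2 by (auto simp: C_def)
  ultimately show ?thesis by (intro exI[of _ C]) auto
qed

text \<open>Both expressions tend to 1 as \<eta> tends to 0 from the right. The first is the
  relative loss of the majorant, the second that of the minorant.\<close>

lemma ex_small_eta:
  fixes \<epsilon> :: real
  assumes "0 < \<epsilon>"
  shows "\<exists>\<eta>. 0 < \<eta> \<and> \<eta> < 1/4 \<and> ((1 + 2 * \<eta>) / (1 - \<eta>)) ^ c \<le> 1 + \<epsilon>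
     \<and> 1 - \<epsilon> \<le> ((1 - \<eta>)\<^sup>2 * (1 - 3 * \<eta>)) ^ c - \<eta> * (1 + 2 * \<eta>) ^ c"
proof -
  have "((\<lambda>\<eta>::real. ((1 + 2 * \<eta>) / (1 - \<eta>)) ^ c) \<longlongrightarrow> ((1 + 2 * 0) / (1 - 0)) ^ c) (at_right 0)"
    by (intro tendsto_intros) simp
  then have 1: "eventually (\<lambda>\<eta>::real. ((1 + 2 * \<eta>) / (1 - \<eta>)) ^ c < 1 + \<epsilon>) (at_right 0)"
    by (rule order_tendstoD) (use assms in auto)
  have "((\<lambda>\<eta>::real. ((1 - \<eta>)\<^sup>2 * (1 - 3 * \<eta>)) ^ c - \<eta> * (1 + 2 * \<eta>) ^ c)
      \<longlongrightarrow> ((1 - 0)\<^sup>2 * (1 - 3 * 0)) ^ c - 0 * (1 + 2 * 0) ^ c) (at_right 0)"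
    by (intro tendsto_intros)
  then have 2: "eventually (\<lambda>\<eta>::real. 1 - \<epsilon> < ((1 - \<eta>)\<^sup>2 * (1 - 3 * \<eta>)) ^ c - \<eta> * (1 + 2
    * \<eta>) ^ c) (at_right 0)"
    by (rule order_tendstoD) (use assms in auto)
  have 3: "eventually (\<lambda>\<eta>::real. \<eta> \<in> {0<..<1/4}) (at_right 0)"
    by (rule eventually_at_right_real) simp
  have "eventually (\<lambda>\<eta>. 0 < \<eta> \<and> \<eta> < 1/4 \<and> ((1 + 2 * \<eta>) / (1 - \<eta>)) ^ c \<le> 1 + \<epsilon>
     \<and> 1 - \<epsilon> \<le> ((1 - \<eta>)\<^sup>2 * (1 - 3 * \<eta>)) ^ c - \<eta> * (1 + 2 * \<eta>) ^ c) (at_right (0::real))"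
    using 1 2 3 by eventually_elim auto
  then show ?thesis by (rule eventually_happens'[rotated]) simp
qed

text \<open>The upper bound divides by the minimum of the product on the box. For the lower bound, a
  product of one-variable minorants could fail, since two negative factors give a positive value; f
  (f - \<eta>) built from the nonnegative product f avoids this.\<close>

lemma near_int_sandwich:
  fixes A :: "real ^ 'c ^ 'r"
  defines "P \<equiv> \<lambda>Q. (UNIV :: 'r set) \<rightarrow>\<^sub>E {1..Q}"
    and "y \<equiv> \<lambda>a k. \<Sum>u\<in>UNIV. real (a u) * A $ u $ k"
  shows near_int_count_le: "\<lbrakk>\<And>x. 0 \<le> T x; \<And>x. int_dist x < \<delta> \<Longrightarrow> 1 - \<eta> \<le> T x; \<eta> \<le> 1\<rbrakk> \<Longrightarrow>
      real (near_int_count A Q \<delta>) * (1 - \<eta>) ^ CARD('c) \<le> (\<Sum>a\<in>P Q. \<Prod>k\<in>UNIV. T (y a k))"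
    and near_int_count_ge: "\<lbrakk>\<And>x. 0 \<le> T x; \<And>x. T x \<le> 1; \<And>x. \<delta> \<le> int_dist x \<Longrightarrow> T x \<le> \<eta>; 0 \<le> \<eta>\<rbrakk> \<Longrightarrow>
      (\<Sum>a\<in>P Q. \<Prod>k\<in>UNIV. T (y a k) * T (y a k)) - \<eta> * (\<Sum>a\<in>P Q. \<Prod>k\<in>UNIV. T (y a k))
        \<le> real (near_int_count A Q \<delta>)"
proof -
  define N where "N = {a \<in> P Q. \<forall>k. int_dist (y a k) < \<delta>}"
  have cN: "near_int_count A Q \<delta> = card N" unfolding N_def P_def y_def by (rule near_int_count_eq)
  have finP: "finite (P Q)" unfolding P_def by (intro finite_PiE) auto
  have NP: "N \<subseteq> P Q" by (auto simp: N_def)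
  show "real (near_int_count A Q \<delta>) * (1 - \<eta>) ^ CARD('c) \<le> (\<Sum>a\<in>P Q. \<Prod>k\<in>UNIV. T (y a k))"
    if T: "\<And>x. 0 \<le> T x" "\<And>x. int_dist x < \<delta> \<Longrightarrow> 1 - \<eta> \<le> T x" "\<eta> \<le> 1"
  proof -
    have "real (near_int_count A Q \<delta>) * (1 - \<eta>) ^ CARD('c) = (\<Sum>a\<in>N. \<Prod>k\<in>(UNIV::'c set). 1 - \<eta>)"
      by (simp add: cN)
    also have "\<dots> \<le> (\<Sum>a\<in>N. \<Prod>k\<in>UNIV. T (y a k))"
      using T by (intro sum_mono prod_mono) (auto simp: N_def)
    also have "\<dots> \<le> (\<Sum>a\<in>P Q. \<Prod>k\<in>UNIV. T (y a k))"
      using T(1) by (intro sum_mono2 finP NP prod_nonneg) auto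
    finally show ?thesis .
  qed
  show "(\<Sum>a\<in>P Q. \<Prod>k\<in>UNIV. T (y a k) * T (y a k)) - \<eta> * (\<Sum>a\<in>P Q. \<Prod>k\<in>UNIV. T (y a k))
        \<le> real (near_int_count A Q \<delta>)"
    if T: "\<And>x. 0 \<le> T x" "\<And>x. T x \<le> 1" "\<And>x. \<delta> \<le> int_dist x \<Longrightarrow> T x \<le> \<eta>" "0 \<le> \<eta>"
  proof -
    define f where "f a = (\<Prod>k\<in>UNIV. T (y a k))" for a
    have f0: "0 \<le> f a" for a using T(1) by (auto simp: f_def intro: prod_nonneg)
    have f1: "f a \<le> 1" for a unfolding f_def using T(1,2) by (intro prod_le_1) auto
    have "(\<Sum>a\<in>P Q. \<Prod>k\<in>UNIV. T (y a k) * T (y a k)) - \<eta> * (\<Sum>a\<in>P Q. \<Prod>k\<in>UNIV. T (y a k))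
        = (\<Sum>a\<in>P Q. f a * (f a - \<eta>))"
      by (simp add: f_def prod.distrib sum_subtractf sum_distrib_left right_diff_distrib mult.commute)
    also have "\<dots> \<le> (\<Sum>a\<in>P Q. if a \<in> N then 1 else 0)"
    proof (rule sum_mono)
      fix a assume a: "a \<in> P Q"
      show "f a * (f a - \<eta>) \<le> (if a \<in> N then 1 else 0)"
      proof (cases "a \<in> N")
        case True
        have "f a * (f a - \<eta>) \<le> f a * 1" using f0 f1[of a] T(4) by (intro mult_left_mono) auto
        then show ?thesis using True f1[of a] by simp
      next
        case False
        \<comment> \<open>One bad coordinate already makes f at most \<eta>, because the other
          factors are at most 1.\<close>
        then obtain l where "\<delta> \<le> int_dist (y a l)" using a by (auto simp: N_def not_less)
        then have "T (y a l) \<le> \<eta>" by (rule T(3))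
        moreover have "f a = T (y a l) * (\<Prod>k\<in>UNIV - {l}. T (y a k))"
          unfolding f_def by (rule prod.remove) auto
        moreover have "\<dots> \<le> T (y a l) * 1"
          using T(1,2) by (intro mult_left_mono prod_le_1) auto
        ultimately have "f a \<le> \<eta>" by simp
        then show ?thesis using False f0[of a] by (simp add: mult_nonneg_nonpos)
      qed
    qed
    also have "\<dots> = real (near_int_count A Q \<delta>)"
      using finP NP by (simp add: cN sum.If_cases Int_absorb1)
    finally show ?thesis .
  qed
qed

text \<open>The sandwich is applied with radius \<delta> + t from above and \<delta> - t from below,
  and each sum is replaced by its mean value up to the frequency sum \<open>R\<close>.\<close>

lemma near_int_count_estimate:
  fixes A :: "real ^ 'c ^ 'r" and \<delta> \<eta> \<epsilon> :: real and N :: nat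
  defines "\<theta> \<equiv> \<lambda>(h :: 'c \<Rightarrow> int) u. \<Sum>k\<in>UNIV. of_int (h k) * A $ u $ k"
    and "H \<equiv> \<lambda>D. (UNIV :: 'c set) \<rightarrow>\<^sub>E {-int D..int D}"
  defines "R \<equiv> (\<Sum>h\<in>H (4 * N) - {\<lambda>_. 0}. \<Prod>u\<in>UNIV. 1 / int_dist (\<theta> h u))"
  assumes \<delta>: "0 < \<delta>" "\<delta> \<le> 1/2" and \<eta>: "0 < \<eta>" "\<eta> < 1/4" and \<epsilon>: "0 < \<epsilon>"
    and up: "((1 + 2 * \<eta>) / (1 - \<eta>)) ^ CARD('c) \<le> 1 + \<epsilon>"
    and lo: "1 - \<epsilon> \<le> ((1 - \<eta>)\<^sup>2 * (1 - 3 * \<eta>)) ^ CARD('c) - \<eta> * (1 + 2 * \<eta>) ^ CARD('c)"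
    and N: "2 / (\<eta>\<^sup>2 * \<delta>) \<le> real N"
    and pos: "\<And>h u. h \<noteq> (\<lambda>_. 0) \<Longrightarrow> 0 < int_dist (\<theta> h u)"
  shows "\<bar>real (near_int_count A Q \<delta>) - (2 * \<delta>) ^ CARD('c) * real Q ^ CARD('r)\<bar>
     \<le> \<epsilon> * (2 * \<delta>) ^ CARD('c) * real Q ^ CARD('r) + (2 + \<epsilon>) * (4 * \<delta>) ^ CARD('c) * R"
proof -
  \<comment> \<open>The squared plateau has degree at most 4N, and recovering its coefficients takes
    a grid of more than 8N points.\<close>
  define M where "M = 8 * N + 1"
  \<comment> \<open>The width of the smoothing zone, a small fraction of \<delta>. The value
    \<open>m\<close> below is 2 \<delta> + 4 t, an upper bound for the means of both
    plateaus.\<close>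
  define t where "t = \<eta> * \<delta>"
  define m where "m = 2 * \<delta> * (1 + 2 * \<eta>)"
  let ?c = "CARD('c)" and ?q = "real Q ^ CARD('r)"
  define S where "S g
    = (\<Sum>a\<in>(UNIV :: 'r set) \<rightarrow>\<^sub>E {1..Q}. \<Prod>k\<in>UNIV. g (\<Sum>u\<in>UNIV. real (a u) * A $ u $ k))"
    for g :: "real \<Rightarrow> real"
  have t: "0 < t" "t \<le> \<delta> / 4" using \<delta> \<eta> by (auto simp: t_def)
  have N0: "0 < real N" using N \<delta> \<eta> by (intro less_le_trans[OF _ N]) auto
  then have N1: "1 \<le> N" by simp
  have M: "2 * N < M" "2 * (4 * N) < M" using N1 by (auto simp: M_def)
  \<comment> \<open>The lower bound on \<open>N\<close> gives N t >= 2 / \<eta>, so the kernel mass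
    beyond \<open>t\<close> is at most \<eta>.\<close>
  have tail: "2 / (real N * t)\<^sup>2 \<le> \<eta>"
  proof -
    have "2 / \<eta> \<le> real N * t" using N \<delta> \<eta> by (simp add: t_def field_simps power2_eq_square)
    then have "(2 / \<eta>)\<^sup>2 \<le> (real N * t)\<^sup>2" using \<eta> by (intro power_mono) auto
    then have "2 / (real N * t)\<^sup>2 \<le> 2 / (2 / \<eta>)\<^sup>2"
      using \<eta> N0 t by (intro divide_left_mono mult_pos_pos zero_less_power) auto
    also have "\<dots> = \<eta> * (\<eta> / 2)" using \<eta> by (simp add: power2_eq_square)
    also have "\<dots> \<le> \<eta> * 1" using \<eta> by (intro mult_left_mono) auto
    finally show ?thesis by simp
  qed
  have Mt: "1 / real M \<le> t"
  proof -
    have "1 / t \<le> 2 / (\<eta>\<^sup>2 * \<delta>)" using \<delta> \<eta> by (simp add: t_def field_simps power2_eq_square)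
    also have "\<dots> \<le> real M" using N by (simp add: M_def)
    finally show ?thesis using t N1 by (simp add: M_def field_simps)
  qed
  have R0: "0 \<le> R" unfolding R_def by (intro sum_nonneg prod_nonneg) (auto simp: int_dist_nonneg)
  have q0: "0 \<le> ?q" by simp
  have S: "\<bar>S g - dmean M g ^ ?c * ?q\<bar> \<le> dmean M g ^ ?c * R"
    if "trig_poly (4 * N) b g" "\<And>x. 0 \<le> g x" for b g
    unfolding S_def R_def \<theta>_def H_def
  proof (rule sum_prod_trig_poly[where c = b])
    show "norm (b j) \<le> dmean M g" if "\<bar>j\<bar> \<le> int (4 * N)" for j
      by (rule trig_poly_coeff_norm_le) fact+
    show "b 0 = of_real (dmean M g)" by (rule trig_poly_coeff_0) fact+
  qed (use that pos[unfolded \<theta>_def] in auto)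
  have dm0: "0 \<le> dmean M g" if "\<And>x. 0 \<le> g x" for g
    using that by (auto simp: dmean_def intro!: divide_nonneg_nonneg sum_nonneg)

  have upper: "real (near_int_count A Q \<delta>) \<le> (2 * \<delta>) ^ ?c * (1 + \<epsilon>) * (?q + R)"
  proof -
    let ?T = "plateau M N (\<delta> + t)"
    obtain b where b: "trig_poly (4 * N) b ?T" using trig_poly_plateau[of N "4 * N"] by auto
    have "dmean M ?T \<le> 2 * (\<delta> + t) + 1 / real M" using M N1 \<delta> t by (intro dmean_plateau_le) auto
    also have "\<dots> \<le> m" using Mt t unfolding m_def t_def by (simp add: algebra_simps)
    finally have dm: "dmean M ?T \<le> m" .
    have "real (near_int_count A Q \<delta>) * (1 - \<eta>) ^ ?c \<le> S ?T"
      unfolding S_def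
    proof (rule near_int_count_le)
      fix x assume "int_dist x < \<delta>"
      then have "1 - 2 / (real N * t)\<^sup>2 \<le> ?T x" using M N1 t by (intro plateau_inside) auto
      then show "1 - \<eta> \<le> ?T x" using tail by linarith
    qed (use \<eta> in \<open>auto simp: plateau_nonneg\<close>)
    also have "\<dots> \<le> dmean M ?T ^ ?c * (?q + R)" using S[OF b plateau_nonneg]
      by (simp add: distrib_left)
    also have "\<dots> \<le> m ^ ?c * (?q + R)"
      using dm dm0[of ?T] R0 by (intro mult_right_mono power_mono) (auto simp: plateau_nonneg)
    finally have "real (near_int_count A Q \<delta>) \<le> m ^ ?c * (?q + R) / (1 - \<eta>) ^ ?c"
      using \<eta> by (simp add: pos_le_divide_eq)
    also have "\<dots> = (2 * \<delta>) ^ ?c * ((1 + 2 * \<eta>) / (1 - \<eta>)) ^ ?c * (?q + R)"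
      by (simp add: m_def power_mult_distrib power_divide)
    also have "\<dots> \<le> (2 * \<delta>) ^ ?c * (1 + \<epsilon>) * (?q + R)"
      using up \<delta> R0 by (intro mult_right_mono mult_left_mono) auto
    finally show ?thesis .
  qed

  have lower: "(2 * \<delta>) ^ ?c * (1 - \<epsilon>) * ?q - 2 * (4 * \<delta>) ^ ?c * R \<le> real (near_int_count A Q \<delta>)"
  proof -
    let ?T = "plateau M N (\<delta> - t)"
    let ?T2 = "\<lambda>x. ?T x * ?T x"
    obtain b where b: "trig_poly (4 * N) b ?T" using trig_poly_plateau[of N "4 * N"] by auto
    obtain b' where "trig_poly (2 * N) b' ?T" using trig_poly_plateau[of N "2 * N"] by auto
    then obtain b2 where "trig_poly (2 * N + 2 * N) b2 ?T2" using trig_poly_mult by blast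
    then have b2: "trig_poly (4 * N) b2 ?T2" by simp
    have T1: "?T x \<le> 1" for x using M N1 by (intro plateau_le_1) auto
    have T20: "0 \<le> ?T2 x" for x by simp
    have "dmean M ?T \<le> 2 * (\<delta> - t) + 1 / real M" using M N1 \<delta> t by (intro dmean_plateau_le) auto
    also have "\<dots> \<le> m" using Mt t unfolding m_def t_def by (simp add: algebra_simps)
    finally have dm: "dmean M ?T \<le> m" .
    have "dmean M ?T2 \<le> dmean M ?T"
      unfolding dmean_def using T1 plateau_nonneg
      by (intro divide_right_mono sum_mono) (auto intro: mult_left_le)
    then have dm2: "dmean M ?T2 \<le> m" using dm by linarith
    have "2 * \<delta> * ((1 - \<eta>)\<^sup>2 * (1 - 3 * \<eta>)) \<le> (1 - \<eta>)\<^sup>2 * (2 * (\<delta> - t - t) - 1 / real M)"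
    proof -
      \<comment> \<open>The right side is at least 2 \<delta> - 5 t, while the left side is 2
        \<delta> - 6 t.\<close>
      have "2 * \<delta> * (1 - 3 * \<eta>) \<le> 2 * (\<delta> - t - t) - 1 / real M"
        using Mt t unfolding t_def by (simp add: algebra_simps)
      then have "(1 - \<eta>)\<^sup>2 * (2 * \<delta> * (1 - 3 * \<eta>)) \<le> (1 - \<eta>)\<^sup>2 * (2 * (\<delta> - t - t) - 1 / real M)"
        by (intro mult_left_mono) auto
      then show ?thesis by (simp only: mult_ac)
    qed
    \<comment> \<open>The unchanged factor is nonnegative because 4 t <= \<delta> and 1 / M <=
      t.\<close>
    also have "\<dots> \<le> (1 - 2 / (real N * t)\<^sup>2)\<^sup>2 * (2 * (\<delta> - t - t) - 1 / real M)"
      using tail \<eta> t Mt by (intro mult_right_mono power_mono) auto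
    also have "\<dots> \<le> dmean M ?T2"
      proof (rule dmean_plateau_square_ge[OF M(1) N1 t(1)])
      show "2 / (real N * t)\<^sup>2 \<le> 1" using tail \<eta> by linarith
    qed (use t \<delta> in auto)
    finally have dm3: "2 * \<delta> * ((1 - \<eta>)\<^sup>2 * (1 - 3 * \<eta>)) \<le> dmean M ?T2" .
    have mc: "m ^ ?c \<le> (4 * \<delta>) ^ ?c" using \<delta> \<eta> by (intro power_mono) (auto simp: m_def)
    have m0: "0 \<le> m" using \<delta> \<eta> by (simp add: m_def)
    have "(2 * \<delta>) ^ ?c * (1 - \<epsilon>) * ?q
      \<le> (2 * \<delta>) ^ ?c * (((1 - \<eta>)\<^sup>2 * (1 - 3 * \<eta>)) ^ ?c - \<eta> * (1 + 2 * \<eta>) ^ ?c) * ?q"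
      using lo \<delta> by (intro mult_right_mono mult_left_mono) auto
    also have "\<dots> = (2 * \<delta> * ((1 - \<eta>)\<^sup>2 * (1 - 3 * \<eta>))) ^ ?c * ?q - \<eta> * (m ^ ?c * ?q)"
      unfolding m_def power_mult_distrib by (simp add: algebra_simps)
    also have "\<dots> \<le> dmean M ?T2 ^ ?c * ?q - \<eta> * (m ^ ?c * ?q)"
      using dm3 \<delta> \<eta> by (intro diff_right_mono mult_right_mono power_mono) auto
    also have "\<dots> \<le> S ?T2 + m ^ ?c * R - \<eta> * (m ^ ?c * ?q)"
    proof -
      have "dmean M ?T2 ^ ?c * R \<le> m ^ ?c * R"
        using dm2 dm0[of ?T2] R0 by (intro mult_right_mono power_mono) auto
      then show ?thesis using S[OF b2 T20] by linarith
    qed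
    \<comment> \<open>The subtracted term must be bounded from the other side, so the upper estimate
      for the sum of the plateau itself enters here.\<close>
    also have "\<dots> \<le> S ?T2 + m ^ ?c * R - \<eta> * (S ?T - m ^ ?c * R)"
    proof -
      have "S ?T \<le> dmean M ?T ^ ?c * (?q + R)" using S[OF b plateau_nonneg]
        by (simp add: distrib_left)
      also have "\<dots> \<le> m ^ ?c * (?q + R)"
        using dm dm0[of ?T] R0 by (intro mult_right_mono power_mono) (auto simp: plateau_nonneg)
      finally have "S ?T - m ^ ?c * R \<le> m ^ ?c * ?q" by (simp add: distrib_left)
      then show ?thesis using \<eta> by (intro diff_left_mono mult_left_mono) auto
    qed
    also have "\<dots> = (S ?T2 - \<eta> * S ?T) + (1 + \<eta>) * (m ^ ?c * R)" by (simp add: algebra_simps)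
    also have "\<dots> \<le> real (near_int_count A Q \<delta>) + 2 * ((4 * \<delta>) ^ ?c * R)"
    proof (intro add_mono mult_mono mc)
      show "S ?T2 - \<eta> * S ?T \<le> real (near_int_count A Q \<delta>)"
        unfolding S_def
      proof (rule near_int_count_ge)
        fix x assume "\<delta> \<le> int_dist x"
        then have "?T x \<le> 2 / (real N * t)\<^sup>2" using M N1 t by (intro plateau_outside) auto
        then show "?T x \<le> \<eta>" using tail by linarith
      qed (use \<eta> T1 in \<open>auto simp: plateau_nonneg\<close>)
    qed (use \<eta> \<delta> R0 m0 in auto)
    finally show ?thesis by simp
  qed

  have arith: "\<bar>x - X * q\<bar> \<le> e * X * q + (2 + e) * Y * r"
    if "x \<le> X * (1 + e) * (q + r)" "X * (1 - e) * q - 2 * Y * r \<le> x"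
      "X * (1 + e) * r \<le> (2 + e) * Y * r" "2 * Y * r \<le> (2 + e) * Y * r" for x X q e Y r :: real
    using that by (auto simp: abs_le_iff algebra_simps)
  show ?thesis
  proof (rule arith[OF upper lower])
    show "(2 * \<delta>) ^ ?c * (1 + \<epsilon>) * R \<le> (2 + \<epsilon>) * (4 * \<delta>) ^ ?c * R"
      unfolding mult.commute[of "2 + \<epsilon>"]
      using \<delta> \<epsilon> R0 by (intro mult_right_mono mult_mono power_mono) auto
    show "2 * (4 * \<delta>) ^ ?c * R \<le> (2 + \<epsilon>) * (4 * \<delta>) ^ ?c * R"
      using \<delta> \<epsilon> R0 by (intro mult_right_mono) auto
  qed
qed

theorem theorem3p2:
  fixes n d :: nat and \<omega> :: real and A :: "real ^ 'c ^ 'r"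
  assumes "1 \<le> d" and "d < n"
    and "CARD('r) = d + 1" and "CARD('c) = n - d"
    and "0 < \<omega>"
    and "0 < (INF j\<in>UNIV - {0 :: int ^ 'c}.
               infnorm (vec_of_int j) powr \<omega> *
               (\<Prod>u\<in>UNIV. int_dist (vec_of_int j \<bullet> row u A)))"
  shows "\<forall>\<epsilon>>0. \<exists>C :: real. \<forall>Q\<ge>1. \<forall>\<delta>\<in>{0<..1/2}.
           \<bar>real (near_int_count A Q \<delta>) - (2 * \<delta>) ^ (n - d) * real Q ^ (d + 1)\<bar>
             \<le> \<epsilon> * \<delta> ^ (n - d) * real Q ^ (d + 1)
               + C * \<delta> powr (real n - real d - \<omega>) * ln (1 / \<delta>) ^ (d + 1)"
proof (intro allI impI)
  fix \<epsilon> :: real assume \<epsilon>: "0 < \<epsilon>"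
  define \<kappa> where "\<kappa> = (INF j\<in>UNIV - {0 :: int ^ 'c}.
               infnorm (vec_of_int j) powr \<omega> *
               (\<Prod>u\<in>UNIV. int_dist (vec_of_int j \<bullet> row u A)))"
  define \<theta> where "\<theta> = (\<lambda>(h :: 'c \<Rightarrow> int) u. \<Sum>k\<in>UNIV. of_int (h k) * A $ u $ k)"
  define H where "H = (\<lambda>D. (UNIV :: 'c set) \<rightarrow>\<^sub>E {-int D..int D})"
  have \<kappa>: "0 < \<kappa>" using assms(6) by (simp only: \<kappa>_def)
  have inner: "vec_of_int (\<chi> k. h k) \<bullet> row u A = \<theta> h u" for h u
    by (simp add: vec_of_int_def row_def inner_vec_def \<theta>_def)
  have dioph: "\<kappa> \<le> infnorm (vec_of_int (\<chi> k. h k)) powr \<omega> * (\<Prod>u\<in>UNIV. int_dist (\<theta> h u))"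
    if "h \<noteq> (\<lambda>_. 0)" for h :: "'c \<Rightarrow> int"
    unfolding \<kappa>_def inner[symmetric]
  proof (rule cINF_lower)
    show "bdd_below ((\<lambda>j. infnorm (vec_of_int j) powr \<omega>
      * (\<Prod>u\<in>UNIV. int_dist (vec_of_int j \<bullet> row u A))) ` (UNIV - {0 :: int ^ 'c}))"
      by (rule bdd_belowI[of _ 0]) (auto intro!: mult_nonneg_nonneg prod_nonneg int_dist_nonneg)
    show "(\<chi> k. h k) \<in> UNIV - {0}" using that by (auto simp: vec_eq_iff)
  qed
  \<comment> \<open>A vanishing factor would make the whole product 0, against the positive
    infimum.\<close>
  have pos: "0 < int_dist (\<theta> h u)" if "h \<noteq> (\<lambda>_. 0)" for h u
  proof (rule ccontr)
    assume "\<not> 0 < int_dist (\<theta> h u)"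
    then have "int_dist (\<theta> h u) = 0" using int_dist_nonneg[of "\<theta> h u"] by linarith
    then have "(\<Prod>u\<in>UNIV. int_dist (\<theta> h u)) = 0" by (auto intro!: prod_zero)
    then show False using dioph[OF that] \<kappa> by (simp only: mult_zero_right)
  qed
  have dioph': "\<kappa> \<le> real E powr \<omega> * (\<Prod>u\<in>UNIV. int_dist (\<theta> h u))"
    if "h \<noteq> (\<lambda>_. 0)" "h \<in> H E" for h E
  proof -
    have "\<bar>real_of_int (h k)\<bar> \<le> real E" for k
    proof -
      have "\<bar>h k\<bar> \<le> int E" using that(2) by (auto simp: H_def PiE_iff abs_le_iff minus_le_iff)
      then show ?thesis by linarith
    qed
    then have "infnorm (vec_of_int (\<chi> k. h k)) \<le> real E"
      by (simp add: infnorm_cart_le_iff vec_of_int_def)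
    then have "infnorm (vec_of_int (\<chi> k. h k)) powr \<omega> \<le> real E powr \<omega>"
      using assms(5) by (intro powr_mono2) (auto simp: infnorm_pos_le)
    then show ?thesis
      by (intro order_trans[OF dioph[OF that(1)]] mult_right_mono prod_nonneg)
        (auto simp: int_dist_nonneg)
  qed
  \<comment> \<open>This compensates the factor 2^c in (2 \<delta>)^c, since the claimed error has
    \<delta>^c.\<close>
  define \<epsilon>' where "\<epsilon>' = \<epsilon> / 2 ^ CARD('c)"
  have \<epsilon>': "0 < \<epsilon>'" using \<epsilon> by (simp add: \<epsilon>'_def)
  obtain \<eta> where \<eta>: "0 < \<eta>" "\<eta> < 1/4" "((1 + 2 * \<eta>) / (1 - \<eta>)) ^ CARD('c) \<le> 1 + \<epsilon>'"
    "1 - \<epsilon>' \<le> ((1 - \<eta>)\<^sup>2 * (1 - 3 * \<eta>)) ^ CARD('c) - \<eta> * (1 + 2 * \<eta>) ^ CARD('c)"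
    using ex_small_eta[OF \<epsilon>'] by blast
  \<comment> \<open>Chosen so that the degree 4N, with N the ceiling of 2 / (\<eta>^2 \<delta>), is
    at most b / \<delta>; the rounding error 1 is at most 1 / \<delta>.\<close>
  define b where "b = 4 * (2 / \<eta>\<^sup>2 + 1)"
  have b: "0 < b" using \<eta> by (auto simp: b_def intro!: add_pos_pos)
  have "\<exists>C\<ge>0. \<forall>\<delta>\<in>{0<..1/2}. \<forall>D\<ge>1. real D \<le> b / \<delta> \<longrightarrow>
     (\<Sum>h\<in>H D - {\<lambda>_. 0}. \<Prod>u\<in>UNIV. 1 / int_dist (\<theta> h u))
       \<le> C * \<delta> powr (- \<omega>) * ln (1 / \<delta>) ^ CARD('r)"
    unfolding \<theta>_def H_def by (rule error_sum_le[OF \<kappa> assms(5) b dioph'[unfolded \<theta>_def H_def]])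
  then obtain C where C: "\<forall>\<delta>\<in>{0<..1/2}. \<forall>D\<ge>1. real D \<le> b / \<delta> \<longrightarrow>
     (\<Sum>h\<in>H D - {\<lambda>_. 0}. \<Prod>u\<in>UNIV. 1 / int_dist (\<theta> h u))
       \<le> C * \<delta> powr (- \<omega>) * ln (1 / \<delta>) ^ CARD('r)"
    by (elim exE conjE)
  show "\<exists>C :: real. \<forall>Q\<ge>1. \<forall>\<delta>\<in>{0<..1/2}.
           \<bar>real (near_int_count A Q \<delta>) - (2 * \<delta>) ^ (n - d) * real Q ^ (d + 1)\<bar>
             \<le> \<epsilon> * \<delta> ^ (n - d) * real Q ^ (d + 1)
               + C * \<delta> powr (real n - real d - \<omega>) * ln (1 / \<delta>) ^ (d + 1)"
  \<comment> \<open>The witness is fixed before \<open>Q\<close> and \<open>\<delta>\<close> are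
    introduced; 4^c comes from (4 \<delta>)^c and \<open>C\<close> from the frequency sum.\<close>
  proof (intro exI[of _ "(2 + \<epsilon>') * 4 ^ CARD('c) * C"] allI impI ballI)
    fix Q :: nat and \<delta> :: real assume \<delta>: "\<delta> \<in> {0<..1/2}"
    define N where "N = nat \<lceil>2 / (\<eta>\<^sup>2 * \<delta>)\<rceil>"
    let ?R = "\<Sum>h\<in>H (4 * N) - {\<lambda>_. 0}. \<Prod>u\<in>UNIV. 1 / int_dist (\<theta> h u)"
    have x0: "0 < 2 / (\<eta>\<^sup>2 * \<delta>)" using \<delta> \<eta> by simp
    have N: "2 / (\<eta>\<^sup>2 * \<delta>) \<le> real N" "real N \<le> 2 / (\<eta>\<^sup>2 * \<delta>) + 1"
      using x0 unfolding N_def by linarith+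
    have "real (4 * N) \<le> b / \<delta>"
    proof -
      have "1 \<le> 1 / \<delta>" using \<delta> by auto
      with N(2) have "real N \<le> 2 / (\<eta>\<^sup>2 * \<delta>) + 1 / \<delta>" by linarith
      then show ?thesis using \<delta> by (simp add: b_def field_simps)
    qed
    moreover have "1 \<le> 4 * N"
    proof -
      have "0 < real N" using N(1) x0 by linarith
      then show ?thesis by simp
    qed
    ultimately have R: "?R \<le> C * \<delta> powr (- \<omega>) * ln (1 / \<delta>) ^ CARD('r)"
      using bspec[OF C \<delta>] by simp
    have "\<bar>real (near_int_count A Q \<delta>) - (2 * \<delta>) ^ CARD('c) * real Q ^ CARD('r)\<bar>
       \<le> \<epsilon>' * (2 * \<delta>) ^ CARD('c) * real Q ^ CARD('r) + (2 + \<epsilon>') * (4 * \<delta>) ^ CARD('c) * ?R"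
      unfolding \<theta>_def H_def using \<delta>
      by (intro near_int_count_estimate[OF _ _ \<eta>(1,2) \<epsilon>' \<eta>(3,4) N(1) pos[unfolded \<theta>_def]]) auto
    also have "\<dots> \<le> \<epsilon>' * (2 * \<delta>) ^ CARD('c) * real Q ^ CARD('r) + (2 + \<epsilon>') * (4 * \<delta>) ^ CARD('c) * (C
      * \<delta> powr (- \<omega>) * ln (1 / \<delta>) ^ CARD('r))"
      using R \<epsilon>' \<delta> by (intro add_left_mono mult_left_mono) auto
    also have "\<dots> = \<epsilon> * \<delta> ^ CARD('c) * real Q ^ CARD('r) + (2 + \<epsilon>') * 4 ^ CARD('c) * C
      * (\<delta> ^ CARD('c) * \<delta> powr (- \<omega>)) * ln (1 / \<delta>) ^ CARD('r)"
      by (simp add: \<epsilon>'_def power_mult_distrib)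
    also have "\<delta> ^ CARD('c) * \<delta> powr (- \<omega>) = \<delta> powr (real n - real d - \<omega>)"
      using \<delta> assms(2,4) by (simp add: powr_realpow[symmetric] powr_add[symmetric] of_nat_diff)
    finally show "\<bar>real (near_int_count A Q \<delta>) - (2 * \<delta>) ^ (n - d) * real Q ^ (d + 1)\<bar>
             \<le> \<epsilon> * \<delta> ^ (n - d) * real Q ^ (d + 1)
               + (2 + \<epsilon>') * 4 ^ CARD('c) * C * \<delta> powr (real n - real d - \<omega>) * ln (1 / \<delta>) ^ (d + 1)"
      using assms(3,4) by simp
  qed
qed

end
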